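(* Let $D$ be a skeletal directed acyclic graph. The canonical join complex of $\mathcal{AR}_D$ is isomorphic, as a simplicial complex, to the non-crossing rope complex of $D$. The canonical meet complex of $\mathcal{AR}_D$ is also isomorphic to the non-crossing rope complex of $D$.
   Context: All directed graphs are finite and simple. A reorientation of a directed acyclic graph $D=(V,A)$ is a directed graph with the same underlying undirected graph, encoded by the set of arcs of $D$ that it reverses. $\mathcal{AR}_D$ is the poset of acyclic reorientations of $D$ ordered by inclusion of sets of reversed arcs. The transitive reduction of a directed acyclic graph is obtained by deleting all arcs whose endpoints are connected by a directed path of length at least $2$. A directed graph is a forest if its underlying undirected graph has no cycle. $D$ is vertebrate if the transitive reduction of every induced subgraph of $D$ is a forest; filled if for any directed path $\pi$ in $D$ whose endpoints are joined by an arc of $D$, all arcs joining any two vertices of $\pi$ belong to $D$; skeletal if vertebrate and filled. When $D$ is skeletal, $\mathcal{AR}_D$ is a semidistributive lattice, so canonical join and meet representations exist. A join representation of an element $x$ of a finite lattice $L$ is a subset $J\subseteq L$ with $x=\bigvee J$; it is irredundant if $x\ne\bigvee J'$ for every strict subset $J'\subsetneq J$. Irredundant join representations of $x$ are ordered by $J\le J'$ if for any $y\in J$ there is $y'\in J'$ with $y\le y'$. The canonical join representation of $x$ is the minimal irredundant join representation for this order. Canonical meet representations are defined dually. The canonical join (resp. meet) complex of a semidistributive lattice $L$ is the simplicial complex on the join (resp. meet) irreducible elements of $L$ whose faces are the canonical join (resp. meet) representations of the elements of $L$. The transitive support of an arc $(u,v)$ of $D$ is the set of vertices appearing along directed paths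 in $D$ from $u$ to $v$. A rope of $D$ is a quadruple $(u,v,\nabla,\Delta)$ where $(u,v)\in A$ and $\nabla\sqcup\Delta$ is a partition of the transitive support of $(u,v)$ minus $\{u,v\}$. Two ropes $(u,v,\nabla,\Delta)$ and $(u',v',\nabla',\Delta')$ are crossing if there are distinct vertices $w\ne w'$ such that $w\in(\nabla\cup\{u,v\})\cap(\Delta'\cup\{u',v'\})$ and $w'\in(\Delta\cup\{u,v\})\cap(\nabla'\cup\{u',v'\})$. A non-crossing rope diagram is a set of ropes of $D$ any two distinct of which are non-crossing. The non-crossing rope complex of $D$ is the simplicial complex on the ropes of $D$ whose faces are the non-crossing rope diagrams. *)

theory Defs
  imports "HOL-Algebra.Order"
begin

section \<open>Directed graphs\<close>

text \<open>A simple digraph is a vertex set together with an arc relation. Acyclicity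
  excludes loops and pairs of opposite arcs, so it already forces simplicity.\<close>

definition dag :: "'a set \<Rightarrow> ('a \<times> 'a) set \<Rightarrow> bool" where
  "dag V A \<longleftrightarrow> finite V \<and> A \<subseteq> V \<times> V \<and> acyclic A"

definition forest :: "('a \<times> 'a) set \<Rightarrow> bool" where
  "forest A \<longleftrightarrow>
    \<not> (\<exists>c. 3 \<le> length c \<and> distinct c \<and>
          (\<forall>i<length c. (c ! i, c ! (Suc i mod length c)) \<in> A \<union> A\<inverse>))"

definition transitive_reduction :: "('a \<times> 'a) set \<Rightarrow> ('a \<times> 'a) set" where
  "transitive_reduction A = A - A O A\<^sup>+"

definition vertebrate :: "'a set \<Rightarrow> ('a \<times> 'a) set \<Rightarrow> bool" where
  "vertebrate V A \<longleftrightarrow> (\<forall>W\<subseteq>V. forest (transitive_reduction (Restr A W)))"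

text \<open>In an acyclic digraph an arc joining two vertices of a directed path
  necessarily points in the direction of the path.\<close>

definition filled :: "('a \<times> 'a) set \<Rightarrow> bool" where
  "filled A \<longleftrightarrow>
    (\<forall>p. p \<noteq> [] \<and> successively (\<lambda>u v. (u, v) \<in> A) p \<and> (hd p, last p) \<in> A \<longrightarrow>
       (\<forall>i j. i < j \<and> j < length p \<longrightarrow> (p ! i, p ! j) \<in> A))"

definition skeletal :: "'a set \<Rightarrow> ('a \<times> 'a) set \<Rightarrow> bool" where
  "skeletal V A \<longleftrightarrow> vertebrate V A \<and> filled A"

definition reorient :: "('a \<times> 'a) set \<Rightarrow> ('a \<times> 'a) set \<Rightarrow> ('a \<times> 'a) set" where
  "reorient A R = (A - R) \<union> R\<inverse>"

definition acyclic_reorientation_poset :: "('a \<times> 'a) set \<Rightarrow> ('a \<times> 'a) set gorder" where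
  "acyclic_reorientation_poset A =
    \<lparr> carrier = {R. R \<subseteq> A \<and> acyclic (reorient A R)}, eq = (=), le = (\<subseteq>) \<rparr>"


section \<open>Simplicial complexes\<close>

text \<open>An abstract simplicial complex is a pair of a vertex set and a set of faces.\<close>

type_synonym 'v complex_pair = "'v set \<times> 'v set set"

definition abstract_complex :: "'v complex_pair \<Rightarrow> bool" where
  "abstract_complex K \<longleftrightarrow>
    (\<forall>S \<in> snd K. finite S \<and> S \<subseteq> fst K \<and> (\<forall>T\<subseteq>S. T \<in> snd K))"

definition complex_isomorphic :: "'v complex_pair \<Rightarrow> 'w complex_pair \<Rightarrow> bool" where
  "complex_isomorphic K K' \<longleftrightarrow>
    abstract_complex K \<and> abstract_complex K' \<and>
    (\<exists>f. bij_betw f (fst K) (fst K') \<and>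
         (\<forall>S \<subseteq> fst K. S \<in> snd K \<longleftrightarrow> f ` S \<in> snd K'))"


section \<open>Canonical join and meet complexes\<close>

text \<open>Joins are expressed relationally through \<^const>\<open>is_lub\<close>, so that the definitions
  make sense for any poset. In particular the join of the empty set is the bottom element.\<close>

definition join_representation :: "('a, 'b) gorder_scheme \<Rightarrow> 'a \<Rightarrow> 'a set \<Rightarrow> bool" where
  "join_representation L x J \<longleftrightarrow> J \<subseteq> carrier L \<and> is_lub L x J"

definition irredundant_join_representation ::
    "('a, 'b) gorder_scheme \<Rightarrow> 'a \<Rightarrow> 'a set \<Rightarrow> bool" where
  "irredundant_join_representation L x J \<longleftrightarrow>
    join_representation L x J \<and> (\<forall>J'. J' \<subset> J \<longrightarrow> \<not> is_lub L x J')"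

definition join_refines :: "('a, 'b) gorder_scheme \<Rightarrow> 'a set \<Rightarrow> 'a set \<Rightarrow> bool" where
  "join_refines L J J' \<longleftrightarrow> (\<forall>y\<in>J. \<exists>y'\<in>J'. y \<sqsubseteq>\<^bsub>L\<^esub> y')"

text \<open>``The minimal'' irredundant join representation is the minimum one, lying below
  all the others.\<close>

definition canonical_join_representation ::
    "('a, 'b) gorder_scheme \<Rightarrow> 'a \<Rightarrow> 'a set \<Rightarrow> bool" where
  "canonical_join_representation L x J \<longleftrightarrow>
    irredundant_join_representation L x J \<and>
    (\<forall>J'. irredundant_join_representation L x J' \<longrightarrow> join_refines L J J')"

definition join_irreducible :: "('a, 'b) gorder_scheme \<Rightarrow> 'a \<Rightarrow> bool" where
  "join_irreducible L x \<longleftrightarrow>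
    x \<in> carrier L \<and> \<not> least L x (carrier L) \<and>
    (\<forall>y\<in>carrier L. \<forall>z\<in>carrier L. is_lub L x {y, z} \<longrightarrow> x = y \<or> x = z)"

definition canonical_join_complex :: "('a, 'b) gorder_scheme \<Rightarrow> 'a complex_pair" where
  "canonical_join_complex L =
    ({x. join_irreducible L x},
     {J. \<exists>x\<in>carrier L. canonical_join_representation L x J})"

text \<open>Meets in a poset are joins in the opposite poset.\<close>

definition canonical_meet_complex :: "('a, 'b) gorder_scheme \<Rightarrow> 'a complex_pair" where
  "canonical_meet_complex L = canonical_join_complex (inv_gorder L)"


section \<open>Ropes\<close>

definition transitive_support :: "('a \<times> 'a) set \<Rightarrow> 'a \<Rightarrow> 'a \<Rightarrow> 'a set" where
  "transitive_support A u v = {w. (u, w) \<in> A\<^sup>* \<and> (w, v) \<in> A\<^sup>*}"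

type_synonym 'a rope = "'a \<times> 'a \<times> 'a set \<times> 'a set"

definition ropes :: "('a \<times> 'a) set \<Rightarrow> 'a rope set" where
  "ropes A = {(u, v, N, D). (u, v) \<in> A \<and> N \<inter> D = {} \<and>
                            N \<union> D = transitive_support A u v - {u, v}}"

fun crossing :: "'a rope \<Rightarrow> 'a rope \<Rightarrow> bool" where
  "crossing (u, v, N, D) (u', v', N', D') \<longleftrightarrow>
    (\<exists>w w'. w \<noteq> w' \<and>
       w \<in> (N \<union> {u, v}) \<inter> (D' \<union> {u', v'}) \<and>
       w' \<in> (D \<union> {u, v}) \<inter> (N' \<union> {u', v'}))"

definition non_crossing_rope_diagram :: "('a \<times> 'a) set \<Rightarrow> 'a rope set \<Rightarrow> bool" where
  "non_crossing_rope_diagram A S \<longleftrightarrow>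
    S \<subseteq> ropes A \<and> pairwise (\<lambda>r s. \<not> crossing r s) S"

definition non_crossing_rope_complex :: "('a \<times> 'a) set \<Rightarrow> 'a rope complex_pair" where
  "non_crossing_rope_complex A = (ropes A, {S. non_crossing_rope_diagram A S})"

end

theory Submission
  imports Defs
begin

text \<open>Skeletality enters only through two consequences: the transitive support of an arc is
  a clique, and a shortest directed cycle of a reorientation is a triangle. Hence \<open>R\<close> is an
  acyclic reorientation iff \<open>R\<close> and \<open>A - R\<close> are both closed under the arcs that complete
  triangles, and joins are given by transitive closure inside \<open>A\<close>.

  A rope \<open>(u, v, N, D)\<close> encodes a minimal acyclic reorientation among those reversing
  \<open>(u, v)\<close>, namely the one that also reverses \<open>(u, w)\<close> for \<open>w \<in> N\<close> and \<open>(w, v)\<close> for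
  \<open>w \<in> D\<close>; these are the join irreducibles. The canonical joinands of \<open>R\<close> correspond to the
  arcs \<open>d \<in> R\<close> for which \<open>R - {d}\<close> is still acyclic. Such arcs are reversed cover relations of
  the reoriented graph, which makes their ropes non-crossing. Conversely, if \<open>r\<close> and \<open>s\<close> do not
  cross, then the joinand of \<open>s\<close> lies below the largest reorientation that is above the unique
  lower cover of the joinand of \<open>r\<close> but not above that joinand itself, so each rope of a
  non-crossing diagram survives in the join of the diagram.

  The meet complex is handled by the antiautomorphism \<open>R \<mapsto> A - R\<close>.\<close>

section \<open>Skeletal digraphs\<close>

lemma trancl_successively:
  assumes "(x, y) \<in> r\<^sup>+"
  obtains p where "successively (\<lambda>u v. (u, v) \<in> r) p" "2 \<le> length p" "hd p = x" "last p = y"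
proof -
  from assms have "\<exists>p. successively (\<lambda>u v. (u, v) \<in> r) p \<and> 2 \<le> length p \<and> hd p = x \<and> last p = y"
  proof induction
    case (base y)
    then show ?case by (intro exI[of _ "[x, y]"]) simp
  next
    case (step y z)
    then obtain p where p: "successively (\<lambda>u v. (u, v) \<in> r) p" "2 \<le> length p"
      "hd p = x" "last p = y" by blast
    then show ?case using step(2)
      by (intro exI[of _ "p @ [z]"]) (auto simp: successively_append_iff hd_append)
  qed
  then show ?thesis using that by blast
qed

text \<open>Transitivity relative to \<open>A\<close>: a composite is required only if it is an arc
  of \<open>A\<close>. Imposed on both \<open>R\<close> and \<open>A - R\<close>, it is the analogue
  of the biclosed inversion sets of permutations.\<close>

definition triangle_closed :: "('a \<times> 'a) set \<Rightarrow> ('a \<times> 'a) set \<Rightarrow> bool" where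
  "triangle_closed A P \<longleftrightarrow> (\<forall>a b c. (a, b) \<in> P \<and> (b, c) \<in> P \<and> (a, c) \<in> A \<longrightarrow> (a, c) \<in> P)"

text \<open>Besides the arcs at \<open>u\<close> and \<open>v\<close>, the arcs of \<open>A\<close>
  from \<open>D\<close> to \<open>N\<close> are forced by closedness of the complement. For a rope,
  sources and targets are disjoint, so no two of these arcs compose.\<close>

fun joinand :: "('a \<times> 'a) set \<Rightarrow> 'a rope \<Rightarrow> ('a \<times> 'a) set" where
  "joinand A (u, v, N, D) = {(a, b) \<in> A. a \<in> insert u D \<and> b \<in> insert v N}"

text \<open>At a descent \<open>(u, v)\<close> of an acyclic \<open>R\<close>, exactly one of
  \<open>(u, w)\<close> and \<open>(w, v)\<close> is reversed for each interior \<open>w\<close>, so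
  testing \<open>(u, w)\<close> alone fixes the partition.\<close>

definition rope_at :: "('a \<times> 'a) set \<Rightarrow> ('a \<times> 'a) set \<Rightarrow> 'a \<times> 'a \<Rightarrow> 'a rope" where
  "rope_at A R = (\<lambda>(u, v). (u, v, {w. (u, w) \<in> R \<and> (w, v) \<in> A},
                                {w. (u, w) \<in> A - R \<and> (w, v) \<in> A}))"

lemma reorient_complement: "R \<subseteq> A \<Longrightarrow> reorient A (A - R) = (reorient A R)\<inverse>"
  by (auto simp: reorient_def)

locale skeletal_dag =
  fixes V :: "'a set" and A :: "('a \<times> 'a) set"
  assumes dag: "dag V A" and skeletal: "skeletal V A"
begin

definition AR :: "('a \<times> 'a) set set" where
  "AR = {R. R \<subseteq> A \<and> acyclic (reorient A R)}"

abbreviation L where "L \<equiv> acyclic_reorientation_poset A"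

lemma acyclic_arcs: "acyclic A" and arcs_subset: "A \<subseteq> V \<times> V" and finite_vertices: "finite V"
  using dag by (auto simp: dag_def)

lemma finite_arcs: "finite A"
  using arcs_subset finite_vertices finite_subset by blast

lemma arc_irrefl: "(a, a) \<notin> A" and arc_asym: "(a, b) \<in> A \<Longrightarrow> (b, a) \<notin> A"
  using acyclic_arcs unfolding acyclic_def by (blast intro: trancl_trans)+

text \<open>Joining a path from \<open>u\<close> to \<open>w\<close> with one from \<open>w\<close>
  to \<open>v\<close> gives a path whose ends are joined by an arc, so filledness supplies every arc
  along it.\<close>

lemma arc_between:
  assumes "(u, v) \<in> A" "(u, w) \<in> A\<^sup>+" "(w, v) \<in> A\<^sup>+"
  shows "(u, w) \<in> A" "(w, v) \<in> A"
proof -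
  obtain p where p: "successively (\<lambda>u v. (u, v) \<in> A) p" "2 \<le> length p" "hd p = u" "last p = w"
    using assms(2) by (rule trancl_successively)
  obtain q where q: "successively (\<lambda>u v. (u, v) \<in> A) q" "2 \<le> length q" "hd q = w" "last q = v"
    using assms(3) by (rule trancl_successively)
  let ?l = "p @ tl q"
  have tlq: "tl q \<noteq> []" "q = w # tl q"
    using q by (cases q; auto)+
  have succ: "successively (\<lambda>u v. (u, v) \<in> A) ?l"
    using p q tlq by (metis successively_Cons successively_append_iff)
  have ends: "hd ?l = u" "last ?l = v" "?l \<noteq> []"
    using p q tlq by (auto simp: hd_append) (metis last.simps)
  have arcs: "(?l ! i, ?l ! k) \<in> A" if "i < k" "k < length ?l" for i k
    using skeletal succ ends assms(1) that unfolding skeletal_def filled_def by metis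
  have nths: "?l ! 0 = u" "?l ! (length p - 1) = w" "?l ! (length ?l - 1) = v"
  proof -
    have "p \<noteq> []" using p(2) by auto
    then show "?l ! (length p - 1) = w"
      using p(4) by (simp add: nth_append last_conv_nth)
    show "?l ! 0 = u" "?l ! (length ?l - 1) = v"
      using ends hd_conv_nth[of ?l] last_conv_nth[of ?l] by metis+
  qed
  have len: "0 < length p - 1" "length p - 1 < length ?l - 1"
    using p tlq by (auto simp: length_greater_0_conv[symmetric] simp del: length_greater_0_conv)
  show "(u, w) \<in> A" using arcs[of 0 "length p - 1"] nths len by simp
  show "(w, v) \<in> A" using arcs[of "length p - 1" "length ?l - 1"] nths len by simp
qed

text \<open>If \<open>a\<close> and \<open>b\<close> were not joined, the transitive reduction
  induced on the four vertices would lose only \<open>(u, v)\<close>, leaving the undirected cycle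
  \<open>u, a, v, b\<close>. This contradicts vertebrateness.\<close>

lemma arc_support_total:
  assumes "(u, v) \<in> A" "(u, a) \<in> A" "(a, v) \<in> A" "(u, b) \<in> A" "(b, v) \<in> A" "a \<noteq> b"
  shows "(a, b) \<in> A \<or> (b, a) \<in> A"
proof (rule ccontr)
  assume contr: "\<not> ?thesis"
  let ?W = "{u, a, v, b}"
  let ?B = "Restr A ?W"
  have B: "?B = {(u, a), (u, b), (a, v), (b, v), (u, v)}"
    using assms contr arc_irrefl arc_asym by auto
  \<comment> \<open>The only composable pairs lead from \<open>u\<close> to \<open>v\<close>, and
    \<open>(u, v)\<close> is present.\<close>
  have closed: "?B\<^sup>+ = ?B"
    by (rule trancl_id) (use B assms arc_irrefl arc_asym in \<open>auto simp: trans_def\<close>)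
  have "transitive_reduction ?B = {(u, a), (u, b), (a, v), (b, v)}"
    unfolding transitive_reduction_def closed unfolding B
    using assms arc_irrefl arc_asym by auto
  then have "\<forall>i<length [u, a, v, b]. ([u, a, v, b] ! i, [u, a, v, b] ! (Suc i mod length [u, a, v, b]))
     \<in> transitive_reduction ?B \<union> (transitive_reduction ?B)\<inverse>"
    by (auto simp: less_Suc_eq)
  moreover have "distinct [u, a, v, b]" using assms arc_irrefl by auto
  ultimately have "\<not> forest (transitive_reduction ?B)"
    unfolding forest_def not_not by (intro exI[of _ "[u, a, v, b]"]) simp
  moreover have "?W \<subseteq> V" using assms arcs_subset by auto
  ultimately show False
    using skeletal unfolding skeletal_def vertebrate_def by blast
qed

lemma support_interior:
  assumes "(u, v) \<in> A"
  shows "transitive_support A u v - {u, v} = {w. (u, w) \<in> A \<and> (w, v) \<in> A}"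
  using arc_between[OF assms] arc_irrefl assms
  by (auto simp: transitive_support_def rtrancl_eq_or_trancl)

lemma reorient_irrefl: "R \<subseteq> A \<Longrightarrow> (x, x) \<notin> reorient A R"
  using arc_irrefl by (auto simp: reorient_def)

lemma reorient_asym: "R \<subseteq> A \<Longrightarrow> (x, y) \<in> reorient A R \<Longrightarrow> (y, x) \<notin> reorient A R"
  using arc_asym by (auto simp: reorient_def)

text \<open>In \<open>A\<close> the three edges form two composable arcs and their composite. A
  directed triangle arises only by reversing the composite alone or the two factors alone, and the
  two closure conditions exclude these.\<close>

lemma no_triangle_reorient:
  assumes "R \<subseteq> A" "triangle_closed A R" "triangle_closed A (A - R)"
    "(x, y) \<in> reorient A R" "(y, z) \<in> reorient A R"
  shows "(z, x) \<notin> reorient A R"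
proof
  assume zx: "(z, x) \<in> reorient A R"
  have "False" if "(x, y) \<in> A" "(y, z) \<in> A" "(z, x) \<in> A" for x y z
    using that acyclic_arcs unfolding acyclic_def by (meson trancl.simps)
  with assms zx show False
    unfolding reorient_def triangle_closed_def by blast
qed

text \<open>A shortest directed cycle of the reorientation has at least four vertices, and it has no
  chord, since a chord in either direction would shorten it. The digraph induced on it then keeps
  all cycle edges in its transitive reduction, against vertebrateness.\<close>

lemma acyclic_reorientI:
  assumes R: "R \<subseteq> A" "triangle_closed A R" "triangle_closed A (A - R)"
  shows "acyclic (reorient A R)"
proof (rule ccontr)
  define G where "G = reorient A R"
  assume "\<not> acyclic (reorient A R)"
  then have ex: "\<exists>n. n > 0 \<and> (\<exists>x. (x, x) \<in> G ^^ n)"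
    unfolding acyclic_def G_def trancl_power by blast
  \<comment> \<open>Closed walks stand in for cycles; minimal length makes the vertices
    distinct.\<close>
  define n where "n = (LEAST n. n > 0 \<and> (\<exists>x. (x, x) \<in> G ^^ n))"
  have n: "n > 0" "\<exists>x. (x, x) \<in> G ^^ n"
    using LeastI_ex[OF ex] unfolding n_def by auto
  have minimal: "(x, x) \<notin> G ^^ m" if "0 < m" "m < n" for m x
    using not_less_Least[of m "\<lambda>n. n > 0 \<and> (\<exists>x. (x, x) \<in> G ^^ n)"] that unfolding n_def by auto
  obtain f where f: "f 0 = f n" "\<And>i. i < n \<Longrightarrow> (f i, f (Suc i)) \<in> G"
    using n(2) unfolding relpow_fun_conv by metis
  have G_sub: "G \<subseteq> A \<union> A\<inverse>" and A_sub: "A \<subseteq> G \<union> G\<inverse>"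
    using R(1) unfolding G_def reorient_def by auto
  have sub: "(f i, f k) \<in> G ^^ (k - i)" if "i \<le> k" "k \<le> n" for i k
    unfolding relpow_fun_conv
    by (rule exI[of _ "\<lambda>m. f (i + m)"]) (use f that in auto)
  \<comment> \<open>Continue from \<open>f k\<close> to \<open>f n = f 0\<close>, then on to
    \<open>f i\<close>.\<close>
  have around: "(f k, f i) \<in> G ^^ (n - k + i)" if "i \<le> k" "k \<le> n" for i k
    using relpow_trans[of "f k" "f n" "n - k" G "f i" i] sub[of k n] sub[of 0 i] that f by auto
  have inj: "f i \<noteq> f k" if "i < k" "k < n" for i k
    using sub[of i k] minimal[of "k - i"] that by auto
  \<comment> \<open>Depending on its orientation, a chord closes one of the two stretches of the
    cycle into a shorter closed walk.\<close>
  have chord: "k = Suc i \<or> (i = 0 \<and> k = n - 1)" if "i < k" "k < n" "(f i, f k) \<in> A \<union> A\<inverse>" for i k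
  proof (rule ccontr)
    assume contr: "\<not> ?thesis"
    from that(3) A_sub consider "(f i, f k) \<in> G" | "(f k, f i) \<in> G" by blast
    then show False
    proof cases
      case 1
      then have "(f k, f k) \<in> G ^^ Suc (n - k + i)"
        using around[of i k] that by (meson less_imp_le relpow_Suc_I)
      moreover have "Suc (n - k + i) < n" using that contr by arith
      ultimately show False using minimal by blast
    next
      case 2
      then have "(f i, f i) \<in> G ^^ Suc (k - i)"
        using sub[of i k] that by (meson less_imp_le relpow_Suc_I)
      moreover have "Suc (k - i) < n" using that contr by arith
      ultimately show False using minimal by blast
    qed
  qed
  have "n \<noteq> 1" using f(1) f(2)[of 0] reorient_irrefl[OF R(1)] unfolding G_def by auto
  moreover have "n \<noteq> 2"
    using f(1) f(2)[of 0] f(2)[of 1] reorient_asym[OF R(1)] unfolding G_def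
    by (auto simp: numeral_2_eq_2)
  moreover have "n \<noteq> 3"
    using f(1) f(2)[of 0] f(2)[of 1] f(2)[of 2] no_triangle_reorient[OF R] unfolding G_def
    by (auto simp: numeral_2_eq_2 numeral_3_eq_3)
  ultimately have n4: "n \<ge> 4" using n(1) by linarith
  let ?W = "f ` {..<n}"
  let ?B = "Restr A ?W"
  have "A \<union> A\<inverse> \<subseteq> V \<times> V" using arcs_subset by auto
  then have W: "?W \<subseteq> V" using f(2) G_sub by blast
  have next_mod: "f (Suc i mod n) = f (Suc i)" if "i < n" for i
    using that f(1) by (cases "Suc i = n") auto
  have red: "(a, b) \<in> transitive_reduction ?B"
    if ab: "(a, b) \<in> A" "{a, b} = {f i, f (Suc i mod n)}" and i: "i < n" for a b i
  proof -
    \<comment> \<open>By filledness, the first vertex \<open>z\<close> of a detour from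
      \<open>a\<close> to \<open>b\<close> would be adjacent to both. On a chordless cycle of length
      at least 4 no vertex neighbours both ends of an edge.\<close>
    have "(a, b) \<notin> ?B O ?B\<^sup>+"
    proof
      assume "(a, b) \<in> ?B O ?B\<^sup>+"
      then obtain z where z: "(a, z) \<in> ?B" "(z, b) \<in> ?B\<^sup>+" by blast
      have "(z, b) \<in> A\<^sup>+" using z(2) trancl_mono by blast
      then have zb: "(z, b) \<in> A" using arc_between[OF ab(1)] z(1) by blast
      obtain k where k: "k < n" "z = f k" using z(1) by auto
      define i' where "i' = Suc i mod n"
      have i': "i' < n" "i' = Suc i \<or> (i = n - 1 \<and> i' = 0)"
        using i n4 unfolding i'_def by (auto simp: mod_Suc)
      have adj: "(f k, f i) \<in> A \<union> A\<inverse>" "(f k, f i') \<in> A \<union> A\<inverse>"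
        using zb z(1) k ab(2) unfolding i'_def by (auto simp: doubleton_eq_iff)
      have near: "k = Suc m \<or> m = Suc k \<or> (m = 0 \<and> k = n - 1) \<or> (k = 0 \<and> m = n - 1)"
        if "m < n" "(f k, f m) \<in> A \<union> A\<inverse>" for m
      proof -
        have "k \<noteq> m" using that arc_irrefl by auto
        then show ?thesis
          using chord[of k m] chord[of m k] that k by (cases "k < m") auto
      qed
      show False using near[OF i adj(1)] near[OF i'(1) adj(2)] i'(2) n4 k(1) i by auto
    qed
    moreover have "(a, b) \<in> ?B"
      using ab i n4 by (auto simp: doubleton_eq_iff)
    ultimately show ?thesis unfolding transitive_reduction_def by blast
  qed
  let ?c = "map f [0..<n]"
  have "(?c ! i, ?c ! (Suc i mod length ?c)) \<in>
      transitive_reduction ?B \<union> (transitive_reduction ?B)\<inverse>" if "i < length ?c" for i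
  proof -
    have i: "i < n" using that by simp
    have "(f i, f (Suc i mod n)) \<in> A \<union> A\<inverse>" using f(2)[OF i] next_mod[OF i] G_sub by auto
    then have "(f i, f (Suc i mod n)) \<in> transitive_reduction ?B \<union> (transitive_reduction ?B)\<inverse>"
      using red[OF _ _ i] by (auto simp: insert_commute)
    then show ?thesis using i n4 by simp
  qed
  moreover have "distinct ?c"
    unfolding distinct_map by (auto simp: inj_on_def) (metis inj nat_neq_iff)
  moreover have "3 \<le> length ?c" using n4 by simp
  ultimately have "\<not> forest (transitive_reduction ?B)"
    unfolding forest_def not_not by (intro exI[of _ ?c]) blast
  then show False
    using skeletal W unfolding skeletal_def vertebrate_def by blast
qed

section \<open>The lattice of acyclic reorientations\<close>

text \<open>Complementing turns every arc of the reorientation around, which preserves acyclicity.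
  This symmetry exchanges joins and meets.\<close>

lemma AR_complement: "R \<in> AR \<Longrightarrow> A - R \<in> AR"
  by (auto simp: AR_def reorient_complement)

lemma AR_D:
  assumes "R \<in> AR"
  shows "R \<subseteq> A" "acyclic (reorient A R)"
  using assms by (simp_all add: AR_def)

text \<open>A path in \<open>R\<close> from \<open>a\<close> to \<open>b\<close> is reversed into a
  path from \<open>b\<close> to \<open>a\<close>, which an unreversed arc \<open>(a, b)\<close>
  would close to a cycle.\<close>

lemma AR_closed:
  assumes "R \<in> AR" "(a, b) \<in> R\<^sup>+" "(a, b) \<in> A"
  shows "(a, b) \<in> R"
proof (rule ccontr)
  let ?O = "reorient A R"
  assume "(a, b) \<notin> R"
  then have "(a, b) \<in> ?O" using assms(3) by (auto simp: reorient_def)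
  moreover have "(b, a) \<in> (R\<inverse>)\<^sup>+" using assms(2) by (simp add: trancl_converse)
  then have "(b, a) \<in> ?O\<^sup>+" by (rule trancl_mono) (auto simp: reorient_def)
  ultimately have "(a, a) \<in> ?O\<^sup>+" by (rule trancl_into_trancl2)
  with AR_D(2)[OF assms(1)] show False by (auto simp: acyclic_def)
qed

lemma AR_iff: "R \<in> AR \<longleftrightarrow> R \<subseteq> A \<and> triangle_closed A R \<and> triangle_closed A (A - R)"
proof
  assume R: "R \<in> AR"
  have "triangle_closed A R" if "R \<in> AR" for R
    unfolding triangle_closed_def using AR_closed[OF that] by (meson trancl.simps)
  then show "R \<subseteq> A \<and> triangle_closed A R \<and> triangle_closed A (A - R)"
    using R AR_complement AR_D(1) by blast
qed (auto simp: AR_def intro: acyclic_reorientI)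

lemma AR_split:
  "R \<in> AR \<Longrightarrow> (a, c) \<in> R \<Longrightarrow> (a, b) \<in> A \<Longrightarrow> (b, c) \<in> A \<Longrightarrow> (a, b) \<in> R \<or> (b, c) \<in> R"
  unfolding AR_iff triangle_closed_def by blast

lemma AR_trans:
  "R \<in> AR \<Longrightarrow> (a, b) \<in> R \<Longrightarrow> (b, c) \<in> R \<Longrightarrow> (a, c) \<in> A \<Longrightarrow> (a, c) \<in> R"
  unfolding AR_iff triangle_closed_def by blast

text \<open>Closedness of the complement survives transitive closure. By induction along the path,
  with last arc \<open>(d, c)\<close>: the vertices \<open>b\<close> and \<open>d\<close> both lie
  in the support of \<open>(a, c)\<close>, hence are comparable. If \<open>b\<close> precedes
  \<open>d\<close>, use induction on \<open>(a, d)\<close>; otherwise split \<open>(d, c)\<close> at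
  \<open>b\<close>.\<close>

lemma trancl_split:
  assumes P: "P \<subseteq> A" "triangle_closed A (A - P)"
    and "(a, c) \<in> P\<^sup>+" "(a, c) \<in> A" "(a, b) \<in> A" "(b, c) \<in> A"
  shows "(a, b) \<in> P\<^sup>+ \<or> (b, c) \<in> P\<^sup>+"
  using assms(3-)
proof (induction arbitrary: b)
  case (base c)
  then show ?case using P unfolding triangle_closed_def by blast
next
  case (step d c)
  have "(a, d) \<in> A\<^sup>+" using step(1) P(1) trancl_mono by blast
  moreover have dc: "(d, c) \<in> A" using step P by blast
  ultimately have ad: "(a, d) \<in> A" using arc_between(1)[OF step(4)] by blast
  show ?case
  proof (cases "b = d")
    case True
    then show ?thesis using step by blast
  next
    case False
    then consider "(b, d) \<in> A" | "(d, b) \<in> A"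
      using arc_support_total[OF step(4) step(5,6) ad dc] by blast
    then show ?thesis
    proof cases
      case 1
      then show ?thesis using step.IH[OF ad step(5)] step(2) by (meson trancl_into_trancl)
    next
      case 2
      then have "(d, b) \<in> P \<or> (b, c) \<in> P"
        using step(2,6) P unfolding triangle_closed_def by blast
      then show ?thesis using step(1) by (meson trancl_into_trancl r_into_trancl)
    qed
  qed
qed

text \<open>The relative transitive closure is closed by construction, and
  \<open>trancl_split\<close> closes its complement. Applied to unions, this yields joins.\<close>

lemma AR_trancl:
  assumes "P \<subseteq> A" "triangle_closed A (A - P)"
  shows "A \<inter> P\<^sup>+ \<in> AR"
  unfolding AR_iff triangle_closed_def using trancl_split[OF assms]
  by (auto intro: trancl_trans)

lemma union_coclosed:
  assumes "\<P> \<subseteq> AR"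
  shows "\<Union>\<P> \<subseteq> A" "triangle_closed A (A - \<Union>\<P>)"
  using assms AR_D(1) AR_split unfolding triangle_closed_def by blast+

lemma AR_Sup:
  assumes "\<P> \<subseteq> AR"
  shows "A \<inter> (\<Union>\<P>)\<^sup>+ \<in> AR"
  using AR_trancl[OF union_coclosed[OF assms]] .

lemma AR_Sup_upper: "\<P> \<subseteq> AR \<Longrightarrow> R \<in> \<P> \<Longrightarrow> R \<subseteq> A \<inter> (\<Union>\<P>)\<^sup>+"
  using union_coclosed(1) by auto

lemma AR_Sup_least:
  assumes "U \<in> AR" "\<And>R. R \<in> \<P> \<Longrightarrow> R \<subseteq> U"
  shows "A \<inter> (\<Union>\<P>)\<^sup>+ \<subseteq> U"
proof -
  have "(\<Union>\<P>)\<^sup>+ \<subseteq> U\<^sup>+" using assms(2) by (intro trancl_mono_subset) blast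
  then show ?thesis using AR_closed[OF assms(1)] by auto
qed

text \<open>De Morgan: the meet is the complement of the join of the complements.\<close>

lemma AR_meet:
  assumes "R \<in> AR" "S \<in> AR"
  obtains M where "M \<in> AR" "M \<subseteq> R" "M \<subseteq> S" "\<And>K. K \<in> AR \<Longrightarrow> K \<subseteq> R \<Longrightarrow> K \<subseteq> S \<Longrightarrow> K \<subseteq> M"
proof -
  let ?P = "{A - R, A - S}"
  let ?M = "A - A \<inter> (\<Union>?P)\<^sup>+"
  have P: "?P \<subseteq> AR" using AR_complement assms by blast
  show ?thesis
  proof (rule that)
    show "?M \<in> AR" using AR_complement AR_Sup[OF P] by blast
    show "?M \<subseteq> R" "?M \<subseteq> S" using AR_D(1)[OF assms(1)] AR_D(1)[OF assms(2)] by auto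
    show "K \<subseteq> ?M" if "K \<in> AR" "K \<subseteq> R" "K \<subseteq> S" for K
    proof -
      have "A \<inter> (\<Union>?P)\<^sup>+ \<subseteq> A - K"
        using AR_Sup_least[OF AR_complement[OF that(1)], of ?P] that by blast
      then show ?thesis using AR_D(1)[OF that(1)] by blast
    qed
  qed
qed

lemma empty_AR: "{} \<in> AR"
  using acyclic_arcs by (auto simp: AR_def reorient_def)

section \<open>Descents\<close>

text \<open>As for permutations, descents index the lower covers: each is \<open>R - {d}\<close>,
  and \<open>descent_outside\<close> shows that there are no others.\<close>

definition descents :: "('a \<times> 'a) set \<Rightarrow> ('a \<times> 'a) set" where
  "descents R = {d \<in> R. R - {d} \<in> AR}"

text \<open>Restoring \<open>(u, v)\<close> can break a closure condition only in a triangle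
  containing it, where \<open>v, w, u\<close> is then a path of the reorientation. The last clause
  records whether \<open>w\<close> lies between, after or before \<open>u\<close> and
  \<open>v\<close> in \<open>A\<close>.\<close>

lemma not_descent:
  assumes "R \<in> AR" "(u, v) \<in> R" "(u, v) \<notin> descents R"
  obtains w where "(v, w) \<in> reorient A R" "(w, u) \<in> reorient A R"
    "(u, w) \<in> A \<and> (w, v) \<in> A \<or> (v, w) \<in> A \<and> (u, w) \<in> A \<or> (w, u) \<in> A \<and> (w, v) \<in> A"
proof -
  have "\<not> (triangle_closed A (R - {(u, v)}) \<and> triangle_closed A (A - (R - {(u, v)})))"
  proof -
    have "R - {(u, v)} \<notin> AR" using assms(2,3) unfolding descents_def by blast
    moreover have "R - {(u, v)} \<subseteq> A" using AR_D(1)[OF assms(1)] by blast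
    ultimately show ?thesis unfolding AR_iff by blast
  qed
  then have "\<exists>w. (v, w) \<in> reorient A R \<and> (w, u) \<in> reorient A R \<and>
    ((u, w) \<in> A \<and> (w, v) \<in> A \<or> (v, w) \<in> A \<and> (u, w) \<in> A \<or> (w, u) \<in> A \<and> (w, v) \<in> A)"
  proof (rule contrapos_np)
    assume no: "\<not> ?thesis"
    note R = AR_D(1)[OF assms(1)]
    have "triangle_closed A (R - {(u, v)})"
      unfolding triangle_closed_def using AR_trans[OF assms(1)] no R
      unfolding reorient_def by blast
    moreover have "triangle_closed A (A - (R - {(u, v)}))"
      unfolding triangle_closed_def using AR_split[OF assms(1)] no R arc_irrefl
      unfolding reorient_def by blast
    ultimately show "triangle_closed A (R - {(u, v)}) \<and> triangle_closed A (A - (R - {(u, v)}))" ..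
  qed
  then show ?thesis using that by blast
qed

text \<open>Take an arc of \<open>R - T\<close> whose ends are closest in rank. If it is no descent,
  a vertex \<open>w\<close> of intermediate rank exists. By minimality the reversed arcs among
  \<open>(u, w)\<close> and \<open>(w, v)\<close> lie in \<open>T\<close>, and closedness of
  \<open>T\<close> or of its complement forces \<open>(u, v)\<close> into \<open>T\<close>.\<close>

lemma descent_outside:
  assumes R: "R \<in> AR" and T: "T \<in> AR" "T \<subset> R"
  obtains d where "d \<in> descents R" "d \<notin> T"
proof -
  define O' where "O' = reorient A R"
  \<comment> \<open>The number of strict predecessors, which grows along every arc of the
    reorientation.\<close>
  define rank where "rank x = card {y. (y, x) \<in> O'\<^sup>+}" for x
  have O'_sub: "O' \<subseteq> A \<union> A\<inverse>" using AR_D(1)[OF R] unfolding O'_def reorient_def by auto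
  have acyc: "acyclic O'" using AR_D(2)[OF R] by (simp add: O'_def)
  have fin: "finite {y. (y, x) \<in> O'\<^sup>+}" for x
  proof -
    have "finite O'" using O'_sub finite_arcs by (simp add: finite_subset)
    then have "finite (fst ` (O'\<^sup>+))" by simp
    moreover have "{y. (y, x) \<in> O'\<^sup>+} \<subseteq> fst ` (O'\<^sup>+)" by force
    ultimately show ?thesis by (rule rev_finite_subset)
  qed
  have mono: "rank x < rank y" if "(x, y) \<in> O'" for x y
    unfolding rank_def
  proof (rule psubset_card_mono[OF fin])
    have "x \<notin> {z. (z, x) \<in> O'\<^sup>+}" using acyc by (simp add: acyclic_def)
    moreover have "x \<in> {z. (z, y) \<in> O'\<^sup>+}" using that by auto
    moreover have "{z. (z, x) \<in> O'\<^sup>+} \<subseteq> {z. (z, y) \<in> O'\<^sup>+}"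
      using that by (auto intro: trancl_into_trancl)
    ultimately show "{z. (z, x) \<in> O'\<^sup>+} \<subset> {z. (z, y) \<in> O'\<^sup>+}" by blast
  qed
  \<comment> \<open>Natural subtraction is exact here: an arc \<open>(u, v)\<close> of
    \<open>R\<close> is reversed, so \<open>rank v < rank u\<close>.\<close>
  obtain u v where uv: "(u, v) \<in> R - T"
    and minimal: "\<And>x y. (x, y) \<in> R - T \<Longrightarrow> rank u - rank v \<le> rank x - rank y"
  proof -
    have "\<exists>d. d \<in> R - T" using T by blast
    then obtain d where "d \<in> R - T"
      "\<And>e. e \<in> R - T \<Longrightarrow> rank (fst d) - rank (snd d) \<le> rank (fst e) - rank (snd e)"
      using exists_least_iff[of "\<lambda>n. \<exists>d \<in> R - T. n = rank (fst d) - rank (snd d)"]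
      by (metis not_le_imp_less)
    then show ?thesis using that[of "fst d" "snd d"] by (metis fst_conv prod.collapse snd_conv)
  qed
  have "(u, v) \<in> descents R"
  proof (rule ccontr)
    assume "(u, v) \<notin> descents R"
    then obtain w where w: "(v, w) \<in> O'" "(w, u) \<in> O'"
      "(u, w) \<in> A \<and> (w, v) \<in> A \<or> (v, w) \<in> A \<and> (u, w) \<in> A \<or> (w, u) \<in> A \<and> (w, v) \<in> A"
      using not_descent[OF R] uv unfolding O'_def by blast
    have "(u, w) \<notin> R - T" "(w, v) \<notin> R - T"
    proof -
      have "rank u - rank w < rank u - rank v" "rank w - rank v < rank u - rank v"
        using mono[OF w(1)] mono[OF w(2)] by arith+
      then show "(u, w) \<notin> R - T" "(w, v) \<notin> R - T" using minimal by (meson not_le)+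
    qed
    moreover have "(u, w) \<in> R \<longleftrightarrow> (u, w) \<in> A" "(w, v) \<in> R \<longleftrightarrow> (w, v) \<in> A"
      using w(1,2) AR_D(1)[OF R] arc_asym unfolding O'_def reorient_def by auto
    moreover have "(v, w) \<notin> T" if "(v, w) \<in> A"
      using w(1) that T AR_D(1)[OF R] arc_asym unfolding O'_def reorient_def by auto
    moreover have "(w, u) \<notin> T" if "(w, u) \<in> A"
      using w(2) that T AR_D(1)[OF R] arc_asym unfolding O'_def reorient_def by auto
    ultimately show False
      using w(3) uv AR_D(1)[OF R] AR_trans[OF T(1), of u w v] AR_split[OF T(1), of u w v]
        AR_split[OF T(1), of w v u] by blast
  qed
  then show ?thesis using that uv by blast
qed

text \<open>A path from \<open>v\<close> to \<open>u\<close> through a third vertex cannot use the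
  arc \<open>(v, u)\<close>, so it survives when \<open>(u, v)\<close> is restored and then closes
  to a cycle. Thus \<open>(v, u)\<close> is a cover relation of the reachability order.\<close>

lemma descent_covers:
  assumes R: "R \<in> AR" and uv: "(u, v) \<in> descents R"
    and "(v, z) \<in> (reorient A R)\<^sup>*" "(z, u) \<in> (reorient A R)\<^sup>*"
  shows "z = v \<or> z = u"
proof (rule ccontr)
  let ?O = "reorient A R" and ?O' = "reorient A (R - {(u, v)})"
  assume "\<not> ?thesis"
  then have vz: "(v, z) \<in> ?O\<^sup>+" and zu: "(z, u) \<in> ?O\<^sup>+"
    using assms by (auto simp: rtrancl_eq_or_trancl)
  have acyc: "acyclic ?O" "acyclic ?O'" using AR_D(2) R uv unfolding descents_def by blast+
  let ?H = "?O - {(v, u)}"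
  have H: "?H \<subseteq> ?O'" by (auto simp: reorient_def)
  have vu: "(v, u) \<in> ?O" using uv by (auto simp: reorient_def descents_def)
  then have ins: "?O = insert (v, u) ?H" by blast
  \<comment> \<open>A path from \<open>v\<close> to \<open>z\<close> using \<open>(v, u)\<close>
    would continue from \<open>u\<close> to \<open>z\<close>; one from \<open>z\<close> to
    \<open>u\<close> using it would first reach \<open>v\<close>. Both contradict
    acyclicity.\<close>
  have "(u, z) \<notin> ?O\<^sup>*" "(z, v) \<notin> ?O\<^sup>*"
    using vz zu acyc(1) unfolding acyclic_def by (meson rtrancl_trancl_trancl trancl_rtrancl_trancl)+
  moreover have "?H\<^sup>* \<subseteq> ?O\<^sup>*" by (intro rtrancl_mono) blast
  ultimately have "(u, z) \<notin> ?H\<^sup>*" "(z, v) \<notin> ?H\<^sup>*" by blast+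
  then have "(v, z) \<in> ?H\<^sup>+" "(z, u) \<in> ?H\<^sup>+"
    using vz zu unfolding ins[THEN arg_cong[where f=trancl]] trancl_insert by blast+
  then have "(v, u) \<in> ?O'\<^sup>+" using H by (meson trancl_mono trancl_trans)
  moreover have "(u, v) \<in> ?O'" using uv AR_D(1)[OF R] by (auto simp: reorient_def descents_def)
  ultimately have "(v, v) \<in> ?O'\<^sup>+" by (rule trancl_into_trancl)
  then show False using acyc(2) by (simp add: acyclic_def)
qed

section \<open>Join irreducibles\<close>

lemma ropes_iff:
  "(u, v, N, D) \<in> ropes A \<longleftrightarrow>
    (u, v) \<in> A \<and> N \<inter> D = {} \<and> N \<union> D = {w. (u, w) \<in> A \<and> (w, v) \<in> A}"
proof -
  have "(u, v, N, D) \<in> ropes A \<longleftrightarrow>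
    (u, v) \<in> A \<and> N \<inter> D = {} \<and> N \<union> D = transitive_support A u v - {u, v}"
    unfolding ropes_def by simp
  then show ?thesis by (cases "(u, v) \<in> A") (simp_all only: support_interior simp_thms)
qed

lemma rope_swap: "(u, v, N, D) \<in> ropes A \<Longrightarrow> (u, v, D, N) \<in> ropes A"
  by (auto simp: ropes_iff)

text \<open>A directed path runs from \<open>u\<close> through \<open>a\<close>, \<open>c\<close>,
  \<open>b\<close> to \<open>v\<close>, where the outer pieces may be trivial.\<close>

lemma rope_between:
  assumes "(u, v, N, D) \<in> ropes A" "a \<in> insert u D" "b \<in> insert v N" "(a, c) \<in> A" "(c, b) \<in> A"
  shows "c \<in> N \<union> D"
proof -
  have r: "(u, v) \<in> A" "N \<union> D = {w. (u, w) \<in> A \<and> (w, v) \<in> A}"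
    using assms(1) unfolding ropes_iff by blast+
  then have "a = u \<or> (u, a) \<in> A" "b = v \<or> (b, v) \<in> A" using assms(2,3) by blast+
  then have "(u, c) \<in> A\<^sup>+" "(c, v) \<in> A\<^sup>+"
    using assms(4,5) by (metis r_into_trancl' trancl_into_trancl)+
  then show ?thesis
    using arc_between[OF r(1), of c] r(2) by blast
qed

text \<open>The parameter \<open>X\<close> treats the joinand and its lower cover together.
  Closedness is vacuous, as no two arcs compose. For the complement, the middle vertex of a triangle
  over \<open>(a, c)\<close> lies in \<open>N\<close> or \<open>D\<close>, which puts
  \<open>(a, b)\<close> or \<open>(b, c)\<close> into the set; neither is
  \<open>(u, v)\<close>.\<close>

lemma joinand_minus_AR:
  assumes r: "(u, v, N, D) \<in> ropes A" and X: "X \<subseteq> {(u, v)}"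
  shows "joinand A (u, v, N, D) - X \<in> AR"
proof -
  have disj: "insert u D \<inter> insert v N = {}" and ends: "u \<notin> N" "v \<notin> D"
    using r arc_irrefl by (auto simp: ropes_iff)
  have "triangle_closed A (joinand A (u, v, N, D) - X)"
    using disj by (auto simp: triangle_closed_def)
  moreover have "triangle_closed A (A - (joinand A (u, v, N, D) - X))"
    unfolding triangle_closed_def
  proof (intro allI impI, rule ccontr)
    fix a b c
    assume abc: "(a, b) \<in> A - (joinand A (u, v, N, D) - X) \<and>
      (b, c) \<in> A - (joinand A (u, v, N, D) - X) \<and> (a, c) \<in> A"
      and "(a, c) \<notin> A - (joinand A (u, v, N, D) - X)"
    then have ac: "a \<in> insert u D" "c \<in> insert v N" by auto
    then have "b \<in> N \<union> D" using rope_between[OF r ac] abc by blast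
    then show False using abc ac ends X r arc_irrefl by (auto simp: ropes_iff)
  qed
  moreover have "joinand A (u, v, N, D) - X \<subseteq> A" by auto
  ultimately show ?thesis unfolding AR_iff by blast
qed

lemma joinand_AR: "r \<in> ropes A \<Longrightarrow> joinand A r \<in> AR"
  by (cases r) (metis Diff_empty empty_subsetI joinand_minus_AR)

text \<open>Splitting \<open>(u, v)\<close> at interior vertices puts \<open>(u, b)\<close> into
  \<open>T\<close> for \<open>b\<close> in \<open>N\<close>, and \<open>(a, v)\<close> for
  \<open>a\<close> in \<open>D\<close>. Splitting \<open>(u, b)\<close> at \<open>a\<close> then
  yields \<open>(a, b)\<close>.\<close>

lemma joinand_subset:
  assumes r: "(u, v, N, D) \<in> ropes A" and T: "T \<in> AR" "(u, v) \<in> T"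
    and N: "\<And>w. w \<in> N \<Longrightarrow> (w, v) \<notin> T" and D: "\<And>w. w \<in> D \<Longrightarrow> (u, w) \<notin> T"
  shows "joinand A (u, v, N, D) \<subseteq> T"
proof
  fix d assume "d \<in> joinand A (u, v, N, D)"
  then obtain a b where ab: "d = (a, b)" "(a, b) \<in> A" "a \<in> insert u D" "b \<in> insert v N" by auto
  have inner: "(u, w) \<in> A" "(w, v) \<in> A" if "w \<in> N \<union> D" for w
    using r that by (auto simp: ropes_iff)
  have "(u, b) \<in> T" using ab(4) N inner AR_split[OF T, of b] T(2) by blast
  moreover have "(a, v) \<in> T" using ab(3) D inner AR_split[OF T, of a] T(2) by blast
  ultimately show "d \<in> T"
    using ab D inner AR_split[OF T(1), of u b a] by blast
qed

lemma joinand_lower_cover: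
  assumes "(u, v, N, D) \<in> ropes A" "T \<in> AR" "T \<subseteq> joinand A (u, v, N, D)"
    "T \<noteq> joinand A (u, v, N, D)"
  shows "T \<subseteq> joinand A (u, v, N, D) - {(u, v)}"
proof -
  have "u \<notin> N" "v \<notin> D" "u \<noteq> v" "N \<inter> D = {}"
    using assms(1) arc_irrefl by (auto simp: ropes_iff)
  then have "(u, v) \<notin> T"
    using joinand_subset[OF assms(1,2)] assms(3,4) by fastforce
  then show ?thesis using assms(3) by blast
qed

lemma arc_in_joinand: "(u, v, N, D) \<in> ropes A \<Longrightarrow> (u, v) \<in> joinand A (u, v, N, D)"
  by (auto simp: ropes_iff)

lemma rope_of_joinand:
  assumes "(u, v, N, D) \<in> ropes A"
  shows "N = {w. (u, w) \<in> joinand A (u, v, N, D)} - {v}"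
proof -
  have "v \<notin> N" "\<And>w. w \<in> N \<Longrightarrow> (u, w) \<in> A"
    using assms arc_irrefl[of v] unfolding ropes_iff by blast+
  then show ?thesis by auto
qed

text \<open>Each rope's arc lies in the other's joinand, so differing ends would precede each other
  in \<open>A\<close> both ways. Once the ends agree, \<open>N\<close> is read off the arcs leaving
  \<open>u\<close>.\<close>

lemma joinand_inj: "inj_on (joinand A) (ropes A)"
proof (rule inj_onI)
  fix r s assume rs: "r \<in> ropes A" "s \<in> ropes A" "joinand A r = joinand A s"
  obtain u v N D u' v' N' D' where eq: "r = (u, v, N, D)" "s = (u', v', N', D')"
    by (cases r, cases s)
  have r: "(u, v) \<in> A" "N \<inter> D = {}" "N \<union> D = {w. (u, w) \<in> A \<and> (w, v) \<in> A}"
    and s: "(u', v') \<in> A" "N' \<inter> D' = {}" "N' \<union> D' = {w. (u', w) \<in> A \<and> (w, v') \<in> A}"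
    using rs by (simp_all add: eq ropes_iff)
  have "(u, v) \<in> joinand A s" "(u', v') \<in> joinand A r"
    using rs arc_in_joinand unfolding eq by blast+
  then have "u = u' \<or> u \<in> D'" "v = v' \<or> v \<in> N'" "u' = u \<or> u' \<in> D" "v' = v \<or> v' \<in> N"
    unfolding eq by auto
  then have "u = u' \<or> (u', u) \<in> A" "v = v' \<or> (v, v') \<in> A"
    "u' = u \<or> (u, u') \<in> A" "v' = v \<or> (v', v) \<in> A"
    using r(3) s(3) by blast+
  then have uv: "u = u'" "v = v'"
    using arc_asym by blast+
  have "N = N'"
    using rope_of_joinand rs uv unfolding eq by metis
  moreover from this have "D = D'" using r s uv by blast
  ultimately show "r = s" using eq uv by blast
qed

section \<open>Joins in the poset, ropes at descents, and join irreducibles\<close>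

lemma carrier_L: "carrier L = AR" and le_L: "le L = (\<subseteq>)"
  by (simp_all add: acyclic_reorientation_poset_def AR_def)

lemma is_lub_iff:
  assumes "J \<subseteq> AR"
  shows "is_lub L x J \<longleftrightarrow>
    x \<in> AR \<and> (\<forall>y\<in>J. y \<subseteq> x) \<and> (\<forall>U\<in>AR. (\<forall>y\<in>J. y \<subseteq> U) \<longrightarrow> x \<subseteq> U)"
proof -
  have "J \<inter> AR = J" using assms by blast
  then show ?thesis unfolding least_def Upper_def carrier_L le_L by blast
qed

lemma is_lub_Sup:
  assumes "\<P> \<subseteq> AR"
  shows "is_lub L (A \<inter> (\<Union>\<P>)\<^sup>+) \<P>"
proof (subst is_lub_iff[OF assms], intro conjI ballI impI)
  show "A \<inter> (\<Union>\<P>)\<^sup>+ \<in> AR" by (rule AR_Sup[OF assms])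
  show "R \<subseteq> A \<inter> (\<Union>\<P>)\<^sup>+" if "R \<in> \<P>" for R using that by (rule AR_Sup_upper[OF assms])
  show "A \<inter> (\<Union>\<P>)\<^sup>+ \<subseteq> U" if "U \<in> AR" "\<forall>R\<in>\<P>. R \<subseteq> U" for U
    using that(1) by (rule AR_Sup_least) (use that(2) in blast)
qed

lemma descentsD: "d \<in> descents R \<Longrightarrow> d \<in> R" "d \<in> descents R \<Longrightarrow> R - {d} \<in> AR"
  unfolding descents_def by blast+

text \<open>Both halves would remain in \<open>R - {(u, v)}\<close>, whose closedness would bring
  \<open>(u, v)\<close> back.\<close>

lemma descent_pair:
  assumes R: "R \<in> AR" and uv: "(u, v) \<in> descents R" and w: "(u, w) \<in> R" "(w, v) \<in> A"
  shows "(w, v) \<notin> R"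
proof
  assume "(w, v) \<in> R"
  then have "(u, w) \<in> R - {(u, v)}" "(w, v) \<in> R - {(u, v)}" "(u, v) \<in> A"
    using w uv AR_D(1)[OF R] arc_irrefl by (auto simp: descents_def)
  then have "(u, v) \<in> R - {(u, v)}"
    using AR_trans[of "R - {(u, v)}"] uv unfolding descents_def by blast
  then show False by simp
qed

lemma rope_at_ropes:
  assumes "R \<in> AR" "d \<in> R"
  shows "rope_at A R d \<in> ropes A"
proof -
  have "R \<subseteq> A" using AR_D(1)[OF assms(1)] .
  then show ?thesis using assms(2) AR_split[OF assms(1)]
    unfolding rope_at_def by (cases d) (auto simp: ropes_iff)
qed

text \<open>By \<open>descent_pair\<close> and the choice of the partition, the arcs that
  \<open>joinand_subset\<close> forbids are absent from \<open>R\<close>, hence from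
  \<open>T\<close>.\<close>

lemma descent_joinand_subset:
  assumes R: "R \<in> AR" and d: "d \<in> descents R" and T: "T \<in> AR" "d \<in> T" "T \<subseteq> R"
  shows "joinand A (rope_at A R d) \<subseteq> T"
proof -
  obtain u v where uv: "d = (u, v)" by (cases d)
  have r: "rope_at A R d \<in> ropes A" using rope_at_ropes[OF R descentsD(1)[OF d]] .
  show ?thesis
    using joinand_subset[OF r[unfolded uv rope_at_def prod.case] T(1)] T descent_pair[OF R d[unfolded uv]]
    unfolding uv rope_at_def prod.case by blast
qed

lemma descent_in_joinand: "R \<in> AR \<Longrightarrow> d \<in> descents R \<Longrightarrow> d \<in> joinand A (rope_at A R d)"
proof (cases d)
  case (Pair u v)
  assume "R \<in> AR" "d \<in> descents R"
  then have "rope_at A R d \<in> ropes A" using rope_at_ropes descentsD(1) by blast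
  then show ?thesis unfolding Pair rope_at_def prod.case by (rule arc_in_joinand)
qed

text \<open>Two descents would express \<open>x\<close> as a join of two lower covers, so a join
  irreducible has exactly one descent \<open>d\<close>; its joinand contains \<open>d\<close> and
  therefore exhausts \<open>x\<close>. Conversely, a joinand has a unique lower cover, which bounds
  everything strictly below.\<close>

lemma join_irreducible_iff: "join_irreducible L x \<longleftrightarrow> x \<in> joinand A ` ropes A"
proof
  assume x: "join_irreducible L x"
  then have xAR: "x \<in> AR"
    and irr: "\<And>y z. y \<in> AR \<Longrightarrow> z \<in> AR \<Longrightarrow> is_lub L x {y, z} \<Longrightarrow> x = y \<or> x = z"
    unfolding join_irreducible_def carrier_L by blast+
  have "x \<noteq> {}"
    using x empty_AR unfolding join_irreducible_def least_def carrier_L le_L by blast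
  then obtain d where d: "d \<in> descents x" using descent_outside[OF xAR empty_AR] by blast
  have only: "e = d" if e: "e \<in> descents x" for e
  proof (rule ccontr)
    assume ne: "e \<noteq> d"
    have sub: "{x - {d}, x - {e}} \<subseteq> AR" using d e descentsD(2) by blast
    have "x \<subseteq> U" if "x - {d} \<subseteq> U" "x - {e} \<subseteq> U" for U using that ne by blast
    then have "is_lub L x {x - {d}, x - {e}}"
      by (subst is_lub_iff[OF sub]) (use xAR in simp)
    then have "x = x - {d} \<or> x = x - {e}" using irr sub by blast
    then show False using d e unfolding descents_def by blast
  qed
  let ?j = "joinand A (rope_at A x d)"
  have r: "rope_at A x d \<in> ropes A" using rope_at_ropes[OF xAR descentsD(1)[OF d]] .
  have "?j \<subseteq> x" using descent_joinand_subset[OF xAR d xAR descentsD(1)[OF d]] by blast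
  moreover have "\<not> ?j \<subset> x"
    using descent_outside[OF xAR joinand_AR[OF r]] only descent_in_joinand[OF xAR d] by blast
  ultimately show "x \<in> joinand A ` ropes A" using r by blast
next
  assume "x \<in> joinand A ` ropes A"
  then obtain u v N D where r: "(u, v, N, D) \<in> ropes A" and x: "x = joinand A (u, v, N, D)" by auto
  note uv = arc_in_joinand[OF r, folded x]
  have xAR: "x \<in> AR" using joinand_AR[OF r] x by simp
  have lower: "x - {(u, v)} \<in> AR" using joinand_minus_AR[OF r] x by blast
  show "join_irreducible L x"
    unfolding join_irreducible_def carrier_L
  proof (intro conjI ballI impI)
    show "\<not> least L x AR" using uv empty_AR unfolding least_def le_L by blast
    fix y z assume yz: "y \<in> AR" "z \<in> AR" "is_lub L x {y, z}"
    have sub: "{y, z} \<subseteq> AR" using yz by blast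
    note lub = yz(3)[unfolded is_lub_iff[OF sub]]
    show "x = y \<or> x = z"
    proof (rule ccontr)
      assume "\<not> ?thesis"
      then have "y \<subseteq> x - {(u, v)}" "z \<subseteq> x - {(u, v)}"
        using joinand_lower_cover[OF r] yz(1,2) lub unfolding x by blast+
      then show False using lub lower uv by blast
    qed
  qed (use xAR in blast)
qed

section \<open>Canonical join representations\<close>

definition canonical_joinands :: "('a \<times> 'a) set \<Rightarrow> ('a \<times> 'a) set set" where
  "canonical_joinands R = (\<lambda>d. joinand A (rope_at A R d)) ` descents R"

lemma canonical_joinands_AR: "R \<in> AR \<Longrightarrow> canonical_joinands R \<subseteq> AR"
  using rope_at_ropes descentsD(1) joinand_AR unfolding canonical_joinands_def by blast

lemma canonical_joinands_lub:
  assumes R: "R \<in> AR"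
  shows "is_lub L R (canonical_joinands R)"
  unfolding is_lub_iff[OF canonical_joinands_AR[OF R]]
proof (intro conjI ballI impI)
  fix y assume "y \<in> canonical_joinands R"
  then show "y \<subseteq> R"
    using descent_joinand_subset[OF R _ R] unfolding canonical_joinands_def descents_def by blast
next
  fix U assume U: "U \<in> AR" "\<forall>y\<in>canonical_joinands R. y \<subseteq> U"
  \<comment> \<open>Passing to the meet with \<open>R\<close> keeps all joinands below and makes
    \<open>descent_outside\<close> applicable.\<close>
  obtain M where M: "M \<in> AR" "M \<subseteq> U" "M \<subseteq> R" "\<And>K. K \<in> AR \<Longrightarrow> K \<subseteq> U \<Longrightarrow> K \<subseteq> R \<Longrightarrow> K \<subseteq> M"
    using AR_meet[OF U(1) R] by blast
  have "M = R"
  proof (rule ccontr)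
    assume "M \<noteq> R"
    then obtain d where d: "d \<in> descents R" "d \<notin> M"
      using descent_outside[OF R M(1)] M(3) by blast
    let ?j = "joinand A (rope_at A R d)"
    have "?j \<in> canonical_joinands R" using d(1) by (auto simp: canonical_joinands_def)
    moreover have "?j \<subseteq> R"
      using descent_joinand_subset[OF R d(1) R descentsD(1)[OF d(1)]] by blast
    ultimately have "?j \<subseteq> M" using M(4) U(2) canonical_joinands_AR[OF R] by blast
    then show False using d descent_in_joinand[OF R] by blast
  qed
  then show "R \<subseteq> U" using M(2) by blast
qed (use R in blast)

text \<open>The descent's arc now points from \<open>v\<close> to \<open>u\<close>; in the
  reachability order \<open>N\<close> comes before both ends and \<open>D\<close> after
  both.\<close>

lemma rope_at_order:
  assumes R: "R \<in> AR" and uv: "(u, v) \<in> descents R" and r: "rope_at A R (u, v) = (u, v, N, D)"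
  shows "w \<in> N \<Longrightarrow> (w, v) \<in> reorient A R" "w \<in> D \<Longrightarrow> (u, w) \<in> reorient A R"
    "w \<in> N \<union> {u, v} \<Longrightarrow> (w, u) \<in> (reorient A R)\<^sup>*"
    "w \<in> D \<union> {u, v} \<Longrightarrow> (v, w) \<in> (reorient A R)\<^sup>*"
proof -
  let ?O = "reorient A R"
  have N: "N = {w. (u, w) \<in> R \<and> (w, v) \<in> A}" and D: "D = {w. (u, w) \<in> A - R \<and> (w, v) \<in> A}"
    using r by (auto simp: rope_at_def)
  show Nv: "(w, v) \<in> ?O" if "w \<in> N"
    using that descent_pair[OF R uv] unfolding N reorient_def by blast
  show uD: "(u, w) \<in> ?O" if "w \<in> D"
    using that unfolding D reorient_def by blast
  have vu: "(v, u) \<in> ?O" using uv unfolding descents_def reorient_def by blast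
  have "(w, u) \<in> ?O\<^sup>*" if "w \<in> N"
    using Nv[OF that] vu by (meson converse_rtrancl_into_rtrancl r_into_rtrancl)
  then show "(w, u) \<in> ?O\<^sup>*" if "w \<in> N \<union> {u, v}"
    using that vu by blast
  have "(v, w) \<in> ?O\<^sup>*" if "w \<in> D"
    using vu uD[OF that] by (meson converse_rtrancl_into_rtrancl r_into_rtrancl)
  then show "(v, w) \<in> ?O\<^sup>*" if "w \<in> D \<union> {u, v}"
    using that vu by blast
qed

text \<open>Membership gives a path \<open>v, v', u', u\<close> in the reorientation, with possibly
  trivial outer steps. Since \<open>(v, u)\<close> is a cover relation, the inner vertices must be
  \<open>v\<close> and \<open>u\<close>.\<close>

lemma descent_in_other_joinand:
  assumes R: "R \<in> AR" and d: "d \<in> descents R" and e: "e \<in> descents R"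
    and in_e: "d \<in> joinand A (rope_at A R e)"
  shows "d = e"
proof -
  let ?O = "reorient A R"
  obtain u v u' v' where eq: "d = (u, v)" "e = (u', v')" by (cases d, cases e)
  obtain N D where r: "rope_at A R (u', v') = (u', v', N, D)" by (auto simp: rope_at_def)
  have ropes: "(u', v', N, D) \<in> ropes A"
    using rope_at_ropes[OF R descentsD(1)[OF e]] r eq by simp
  have uv: "u \<in> insert u' D" "v \<in> insert v' N" using in_e unfolding eq r by auto
  note ord = rope_at_order[OF R e[unfolded eq] r]
  have "(v', u') \<in> ?O" using e unfolding eq descents_def reorient_def by blast
  have "(v, v') \<in> ?O\<^sup>*" "(u', u) \<in> ?O\<^sup>*" using uv ord(1,2) by blast+
  moreover have "(v', u) \<in> ?O\<^sup>*" "(v, u') \<in> ?O\<^sup>*"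
    using uv ord(3,4) by blast+
  ultimately have "v' = v \<or> v' = u" "u' = v \<or> u' = u"
    using descent_covers[OF R d[unfolded eq]] by blast+
  moreover have "v' \<noteq> u" "u' \<noteq> v"
    using uv ropes arc_irrefl unfolding ropes_iff by blast+
  ultimately show ?thesis unfolding eq by blast
qed

text \<open>When the joinand of \<open>d\<close> is omitted, all remaining ones avoid
  \<open>d\<close> and so lie below \<open>R - {d}\<close>.\<close>

lemma canonical_joinands_irredundant:
  assumes R: "R \<in> AR"
  shows "irredundant_join_representation L R (canonical_joinands R)"
  unfolding irredundant_join_representation_def join_representation_def carrier_L
proof (intro conjI allI impI canonical_joinands_AR canonical_joinands_lub R notI)
  fix J assume J: "J \<subset> canonical_joinands R" "is_lub L R J"
  then have "J \<subseteq> AR" using canonical_joinands_AR[OF R] by blast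
  note lub = J(2)[unfolded is_lub_iff[OF this]]
  obtain d where d: "d \<in> descents R" "joinand A (rope_at A R d) \<notin> J"
    using J(1) unfolding canonical_joinands_def by blast
  have "y \<subseteq> R - {d}" if y: "y \<in> J" for y
  proof -
    obtain e where "e \<in> descents R" "y = joinand A (rope_at A R e)"
      using J(1) y unfolding canonical_joinands_def by blast
    then have "d \<notin> y" using descent_in_other_joinand[OF R d(1)] d(2) y by blast
    then show ?thesis using lub y by blast
  qed
  then show False using lub d(1) unfolding descents_def by blast
qed

text \<open>In any join representation some member contains the descent \<open>d\<close>, since
  otherwise \<open>R - {d}\<close> would be an upper bound; that member contains the joinand of
  \<open>d\<close> by minimality.\<close>

lemma canonical_joinands_canonical:
  assumes R: "R \<in> AR"
  shows "canonical_join_representation L R (canonical_joinands R)"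
  unfolding canonical_join_representation_def join_refines_def le_L
proof (intro conjI allI impI ballI canonical_joinands_irredundant R)
  fix J y assume J: "irredundant_join_representation L R J" and "y \<in> canonical_joinands R"
  then obtain d where d: "d \<in> descents R" and y: "y = joinand A (rope_at A R d)"
    unfolding canonical_joinands_def by blast
  have JAR: "J \<subseteq> AR" and "is_lub L R J"
    using J unfolding irredundant_join_representation_def join_representation_def carrier_L by auto
  note lub = this(2)[unfolded is_lub_iff[OF this(1)]]
  have "\<exists>y'\<in>J. d \<in> y'"
  proof (rule ccontr)
    assume "\<not> ?thesis"
    then have "\<forall>y'\<in>J. y' \<subseteq> R - {d}" using lub by blast
    then show False using lub d unfolding descents_def by blast
  qed
  then obtain y' where y': "y' \<in> J" "d \<in> y'" by blast
  then have "y \<subseteq> y'"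
    unfolding y using lub JAR by (intro descent_joinand_subset[OF R d]) blast+
  then show "\<exists>y'\<in>J. y \<subseteq> y'" using y'(1) by blast
qed

lemma irredundant_antichain:
  assumes J: "irredundant_join_representation L x J" and "y \<in> J" "z \<in> J" "y \<subseteq> z"
  shows "y = z"
proof (rule ccontr)
  assume "y \<noteq> z"
  have JAR: "J \<subseteq> AR" and lub: "is_lub L x J" and irr: "\<And>J'. J' \<subset> J \<Longrightarrow> \<not> is_lub L x J'"
    using J unfolding irredundant_join_representation_def join_representation_def carrier_L by auto
  have "J - {y} \<subseteq> AR" using JAR by blast
  then have "is_lub L x (J - {y})"
  proof (subst is_lub_iff, assumption, intro conjI ballI impI)
    note lub' = lub[unfolded is_lub_iff[OF JAR]]
    show "x \<in> AR" using lub' by blast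
    show "y' \<subseteq> x" if "y' \<in> J - {y}" for y' using lub' that by blast
    fix U assume U: "U \<in> AR" "\<forall>y'\<in>J - {y}. y' \<subseteq> U"
    then have "z \<subseteq> U" using \<open>y \<noteq> z\<close> assms(3) by blast
    then have "\<forall>y'\<in>J. y' \<subseteq> U" using U(2) assms(4) by blast
    then show "x \<subseteq> U" using lub' U(1) by blast
  qed
  then show False using irr assms(2) by blast
qed

text \<open>Refining there and back gives \<open>y \<subseteq> z \<subseteq> y'\<close>, and an
  irredundant representation is an antichain.\<close>

lemma canonical_join_representation_unique:
  assumes "canonical_join_representation L x J" "canonical_join_representation L x J'"
  shows "J \<subseteq> J'"
proof
  fix y assume y: "y \<in> J"
  note c = assms[unfolded canonical_join_representation_def join_refines_def le_L]
  obtain z where z: "z \<in> J'" "y \<subseteq> z" using c y by blast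
  obtain y' where y': "y' \<in> J" "z \<subseteq> y'" using c z by blast
  have "y = y'" using irredundant_antichain[of x J y y'] c y y' z by blast
  then have "y = z" using z(2) y'(2) by (simp add: subset_antisym)
  then show "y \<in> J'" using z(1) by simp
qed

lemma canonical_join_representation_iff:
  assumes "R \<in> AR"
  shows "canonical_join_representation L R J \<longleftrightarrow> J = canonical_joinands R"
  using canonical_join_representation_unique[of R J "canonical_joinands R"]
    canonical_join_representation_unique[of R "canonical_joinands R" J]
    canonical_joinands_canonical[OF assms] by (metis subset_antisym)

section \<open>Non-crossing rope diagrams\<close>

text \<open>The reorientation has paths from \<open>v'\<close> via \<open>w\<close> to
  \<open>u\<close> and from \<open>v\<close> via \<open>w'\<close> to \<open>u'\<close>. If
  \<open>w\<close> were in \<open>N\<close>, the arc \<open>(w, v)\<close> would place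
  \<open>w\<close> and \<open>v\<close> between \<open>v'\<close> and \<open>u'\<close>; the cover
  property forces \<open>w = v'\<close> and \<open>v = u'\<close>, so \<open>(w, v)\<close> would be
  opposite to \<open>(u', v')\<close>. The case of \<open>D\<close> is dual.\<close>

lemma descent_ropes_crossing:
  assumes R: "R \<in> AR" and d: "(u, v) \<in> descents R" and e: "(u', v') \<in> descents R"
    and r: "rope_at A R (u, v) = (u, v, N, D)" and s: "rope_at A R (u', v') = (u', v', N', D')"
    and w: "w \<in> N \<union> {u, v}" "w \<in> D' \<union> {u', v'}"
    and w': "w' \<in> D \<union> {u, v}" "w' \<in> N' \<union> {u', v'}"
  shows "w \<in> {u, v} \<and> w' \<in> {u, v}"
proof -
  let ?O = "reorient A R"
  note r_ord = rope_at_order[OF R d r] and s_ord = rope_at_order[OF R e s]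
  have path: "(v', w) \<in> ?O\<^sup>*" "(w, u) \<in> ?O\<^sup>*" "(v, w') \<in> ?O\<^sup>*" "(w', u') \<in> ?O\<^sup>*"
    using r_ord(3,4) s_ord(3,4) w w' by blast+
  have cyc: "(y, x) \<notin> ?O\<^sup>*" if "(x, y) \<in> ?O" for x y
    using rtrancl_into_trancl2[OF that] AR_D(2)[OF R] unfolding acyclic_def by blast
  have ropes: "(u, v, N, D) \<in> ropes A" "(u', v', N', D') \<in> ropes A"
    using rope_at_ropes[OF R descentsD(1)[OF d]] rope_at_ropes[OF R descentsD(1)[OF e]] r s by simp_all
  note cov = descent_covers[OF R e]
  have "w \<notin> N"
  proof
    assume N: "w \<in> N"
    note wv = r_ord(1)[OF N]
    have "(w, u') \<in> ?O\<^sup>*" "(v', v) \<in> ?O\<^sup>*" "(v, u') \<in> ?O\<^sup>*"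
      using path wv by (meson rtrancl_trans r_into_rtrancl)+
    then have "w = v' \<or> w = u'" "v = v' \<or> v = u'" using cov path by blast+
    moreover have "w \<noteq> u'" using cyc[OF wv] path by (meson rtrancl_trans)
    moreover have "w \<noteq> v" using wv reorient_irrefl AR_D(1)[OF R] by blast
    ultimately have "w = v'" "v = u'" by blast+
    then show False using N ropes arc_asym unfolding ropes_iff by blast
  qed
  moreover have "w' \<notin> D"
  proof
    assume D: "w' \<in> D"
    note uw = r_ord(2)[OF D]
    have "(u, u') \<in> ?O\<^sup>*" "(v', u) \<in> ?O\<^sup>*" "(v', w') \<in> ?O\<^sup>*"
      using path uw by (meson rtrancl_trans r_into_rtrancl)+
    then have "u = v' \<or> u = u'" "w' = v' \<or> w' = u'" using cov path by blast+
    moreover have "u \<noteq> u'" using cyc[OF uw] path by blast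
    moreover have "w' \<noteq> u" using uw reorient_irrefl AR_D(1)[OF R] by blast
    ultimately have "u = v'" "w' = u'" by blast+
    then show False using D ropes arc_asym unfolding ropes_iff by blast
  qed
  ultimately show ?thesis using w w' by blast
qed

lemma descent_ropes_non_crossing:
  assumes R: "R \<in> AR"
  shows "non_crossing_rope_diagram A (rope_at A R ` descents R)"
  unfolding non_crossing_rope_diagram_def pairwise_def
proof (intro conjI ballI impI notI)
  show "rope_at A R ` descents R \<subseteq> ropes A"
    using rope_at_ropes[OF R descentsD(1)] by blast
next
  fix r s
  assume "r \<in> rope_at A R ` descents R" "s \<in> rope_at A R ` descents R" "r \<noteq> s" and cr: "crossing r s"
  then obtain u v u' v' where d: "(u, v) \<in> descents R" "(u', v') \<in> descents R"
    and rs: "r = rope_at A R (u, v)" "s = rope_at A R (u', v')" and ne: "(u, v) \<noteq> (u', v')" by auto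
  obtain N D N' D' where eq: "rope_at A R (u, v) = (u, v, N, D)" "rope_at A R (u', v') = (u', v', N', D')"
    by (auto simp: rope_at_def)
  obtain w w' where w: "w \<noteq> w'" "w \<in> N \<union> {u, v}" "w \<in> D' \<union> {u', v'}"
    "w' \<in> D \<union> {u, v}" "w' \<in> N' \<union> {u', v'}"
    using cr unfolding rs eq by auto
  \<comment> \<open>Exchanging the ropes exchanges the two witnesses, so the lemma applies both ways
    and the two arcs share both ends.\<close>
  have "w \<in> {u, v} \<and> w' \<in> {u, v}" "w' \<in> {u', v'} \<and> w \<in> {u', v'}"
    using descent_ropes_crossing[OF R d eq w(2-)]
      descent_ropes_crossing[OF R d(2,1) eq(2,1) w(5,4,3,2)] by auto
  then have "u = v' \<and> v = u'" using w(1) ne by blast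
  then show False using d AR_D(1)[OF R] arc_asym unfolding descents_def by blast
qed

text \<open>\<open>A - joinand A (u, v, D, N)\<close> is the largest acyclic reorientation that contains the
  lower cover of \<open>joinand A (u, v, N, D)\<close> but not \<open>(u, v)\<close>.\<close>

lemma non_crossing_separated:
  assumes "r \<in> ropes A" "(u, v, N, D) \<in> ropes A" "\<not> crossing (u, v, N, D) r"
  shows "joinand A r \<subseteq> A - joinand A (u, v, D, N)"
proof (cases r)
  case (fields u' v' N' D')
  \<comment> \<open>An arc \<open>(a, b)\<close> common to \<open>joinand A r\<close> and
    \<open>joinand A (u, v, D, N)\<close> would make the ropes cross, with witnesses
    \<open>a\<close> and \<open>b\<close>.\<close>
  have "a \<noteq> b" if "(a, b) \<in> A" for a b using that arc_irrefl by blast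
  then show ?thesis using assms(3) unfolding fields by auto
qed

text \<open>All generating arcs except \<open>(u, v)\<close> lie in \<open>?m\<close>. So
  \<open>(u, v)\<close> is lost once its joinand is replaced by the lower cover, which makes it a
  descent, and \<open>?m\<close> also dictates how the join treats the interior vertices.\<close>

lemma non_crossing_descents:
  assumes S: "non_crossing_rope_diagram A S" and r: "(u, v, N, D) \<in> S"
    and R_def: "R = A \<inter> (\<Union>(joinand A ` S))\<^sup>+"
  shows "(u, v) \<in> descents R" "rope_at A R (u, v) = (u, v, N, D)"
proof -
  let ?r = "(u, v, N, D)" and ?P = "\<Union>(joinand A ` S)"
  let ?j = "joinand A ?r"
  let ?m = "A - joinand A (u, v, D, N)"
  have ropes: "S \<subseteq> ropes A" and rA: "?r \<in> ropes A"
    using S r unfolding non_crossing_rope_diagram_def by auto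
  then have joinands: "joinand A ` S \<subseteq> AR" using joinand_AR by blast
  have R: "R \<in> AR" using AR_Sup[OF joinands] R_def by simp
  have upper: "joinand A s \<subseteq> R" if "s \<in> S" for s
    using AR_Sup_upper[OF joinands] that R_def by blast
  have m: "?m \<in> AR" using AR_complement[OF joinand_AR[OF rope_swap[OF rA]]] .
  have uv_m: "(u, v) \<notin> ?m" by auto
  have other: "joinand A s \<subseteq> ?m" if "s \<in> S" "s \<noteq> ?r" for s
  proof (rule non_crossing_separated[OF _ rA])
    show "s \<in> ropes A" using that(1) ropes by blast
    show "\<not> crossing ?r s"
      using S r that pairwiseD unfolding non_crossing_rope_diagram_def by metis
  qed
  have self: "?j - {(u, v)} \<subseteq> ?m"
  proof -
    have "N \<inter> D = {}" using rA unfolding ropes_iff by blast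
    then show ?thesis by auto
  qed
  have P_m: "?P - {(u, v)} \<subseteq> ?m" using other self by blast
  have uvR: "(u, v) \<in> R" using upper[OF r] arc_in_joinand[OF rA] by blast
  have P_sub: "?P \<subseteq> A" using union_coclosed(1)[OF joinands] .
  show "(u, v) \<in> descents R"
  proof -
    \<comment> \<open>The joinand of \<open>?r\<close> is replaced by its lower cover. A descent
      outside the new join must be \<open>(u, v)\<close>, since for any other \<open>d\<close> the
      set \<open>R - {d}\<close> would bound all original joinands.\<close>
    let ?Q = "insert (?j - {(u, v)}) (joinand A ` (S - {?r}))"
    have Q: "?Q \<subseteq> AR" using joinands joinand_minus_AR[OF rA] by blast
    let ?R' = "A \<inter> (\<Union>?Q)\<^sup>+"
    have R'_m: "?R' \<subseteq> ?m" by (rule AR_Sup_least[OF m]) (use other self in blast)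
    moreover have "?R' \<subseteq> R" by (rule AR_Sup_least[OF R]) (use upper r in blast)
    ultimately have "?R' \<subset> R" using uvR uv_m by blast
    then obtain d where d: "d \<in> descents R" "d \<notin> ?R'"
      using descent_outside[OF R AR_Sup[OF Q]] by blast
    have "d = (u, v)"
    proof (rule ccontr)
      assume ne: "d \<noteq> (u, v)"
      have d_notin: "d \<notin> joinand A s" if "s \<in> S" for s
      proof (cases "s = ?r")
        case True
        then show ?thesis using AR_Sup_upper[OF Q, of "?j - {(u, v)}"] d(2) ne by blast
      next
        case False
        then show ?thesis using AR_Sup_upper[OF Q, of "joinand A s"] d(2) that by blast
      qed
      have "A \<inter> (\<Union>(joinand A ` S))\<^sup>+ \<subseteq> R - {d}"
        by (rule AR_Sup_least[OF descentsD(2)[OF d(1)]]) (use d_notin upper in blast)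
      then show False using descentsD(1)[OF d(1)] unfolding R_def by blast
    qed
    then show ?thesis using d(1) by simp
  qed
  \<comment> \<open>A generating path from \<open>a\<close> to \<open>b\<close> through
    \<open>(u, v)\<close> would return to \<open>u\<close> from \<open>a\<close>, or reach
    \<open>b\<close> from \<open>v\<close>, closing a cycle of \<open>A\<close>. Hence it stays in
    \<open>?m\<close>.\<close>
  have avoid: "(a, b) \<in> ?m"
    if ab: "(a, b) \<in> R" and ends: "(u, a) \<in> A \<and> b = v \<or> a = u \<and> (b, v) \<in> A" for a b
  proof -
    have "(a, b) \<in> ?P\<^sup>+" using ab R_def by blast
    moreover have "?P \<subseteq> insert (u, v) (?P - {(u, v)})" by blast
    ultimately have "(a, b) \<in> (insert (u, v) (?P - {(u, v)}))\<^sup>+" by (rule trancl_mono)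
    moreover have "\<not> ((a, u) \<in> (?P - {(u, v)})\<^sup>* \<and> (v, b) \<in> (?P - {(u, v)})\<^sup>*)"
    proof
      assume "(a, u) \<in> (?P - {(u, v)})\<^sup>* \<and> (v, b) \<in> (?P - {(u, v)})\<^sup>*"
      then have "(a, u) \<in> A\<^sup>*" "(v, b) \<in> A\<^sup>*"
        using rtrancl_mono[of "?P - {(u, v)}" A] P_sub by blast+
      then show False
        using ends acyclic_arcs rtrancl_into_trancl2[of _ _ A] unfolding acyclic_def by blast
    qed
    ultimately have "(a, b) \<in> (?P - {(u, v)})\<^sup>+" unfolding trancl_insert by blast
    then have "(a, b) \<in> ?m\<^sup>+" using P_m by (rule trancl_mono)
    then show ?thesis using AR_closed[OF m] ab AR_D(1)[OF R] by blast
  qed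
  have inner: "(u, w) \<in> A" "(w, v) \<in> A" if "w \<in> N \<union> D" for w
    using rA that unfolding ropes_iff by blast+
  \<comment> \<open>The arcs \<open>(w, v)\<close> for \<open>w\<close> in \<open>N\<close> and
    \<open>(u, w)\<close> for \<open>w\<close> in \<open>D\<close> belong to
    \<open>joinand A (u, v, D, N)\<close>, which \<open>?m\<close> omits.\<close>
  have "(w, v) \<notin> R" if "w \<in> N" for w
    using avoid[of w v] inner[of w] that by auto
  then have N: "(u, w) \<in> R" if "w \<in> N" for w
    using AR_split[OF R uvR, of w] inner[of w] that by blast
  have D: "(u, w) \<notin> R" if "w \<in> D" for w
    using avoid[of u w] inner[of w] that by auto
  have "R \<subseteq> A" "\<And>w. (u, w) \<in> A \<Longrightarrow> (w, v) \<in> A \<Longrightarrow> w \<in> N \<union> D"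
    using AR_D(1)[OF R] rA unfolding ropes_iff by blast+
  then have "{w. (u, w) \<in> R \<and> (w, v) \<in> A} = N" "{w. (u, w) \<in> A - R \<and> (w, v) \<in> A} = D"
    using N D inner by blast+
  then show "rope_at A R (u, v) = ?r" unfolding rope_at_def by simp
qed

text \<open>Injectivity identifies \<open>S\<close> with the ropes at the descents of
  \<open>R\<close>. Conversely, the joinands of \<open>S\<close> are canonical joinands of their
  join, and irredundancy leaves no room for a proper subset.\<close>

lemma joinand_image_face_iff:
  assumes S: "S \<subseteq> ropes A"
  shows "(\<exists>R\<in>AR. canonical_join_representation L R (joinand A ` S)) \<longleftrightarrow>
    non_crossing_rope_diagram A S"
proof
  assume "\<exists>R\<in>AR. canonical_join_representation L R (joinand A ` S)"
  then obtain R where R: "R \<in> AR" "joinand A ` S = joinand A ` rope_at A R ` descents R"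
    using canonical_join_representation_iff by (auto simp: canonical_joinands_def image_image simp del: joinand.simps)
  have "rope_at A R ` descents R \<subseteq> ropes A"
    using rope_at_ropes[OF R(1) descentsD(1)] by blast
  then have "S = rope_at A R ` descents R"
    using R(2) S inj_on_image_eq_iff[OF joinand_inj, of S "rope_at A R ` descents R"] by simp
  then show "non_crossing_rope_diagram A S" using descent_ropes_non_crossing[OF R(1)] by simp
next
  assume NC: "non_crossing_rope_diagram A S"
  define R where "R = A \<inter> (\<Union>(joinand A ` S))\<^sup>+"
  have joinands: "joinand A ` S \<subseteq> AR" using S joinand_AR by blast
  have R: "R \<in> AR" using AR_Sup[OF joinands] R_def by simp
  have "joinand A ` S \<subseteq> canonical_joinands R"
  proof (rule image_subsetI)
    fix r assume "r \<in> S"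
    moreover obtain u v N D where "r = (u, v, N, D)" by (cases r)
    ultimately have "(u, v) \<in> descents R" "r = rope_at A R (u, v)"
      using non_crossing_descents[OF NC _ R_def] by metis+
    then show "joinand A r \<in> canonical_joinands R"
      unfolding canonical_joinands_def by blast
  qed
  moreover have "is_lub L R (joinand A ` S)" using is_lub_Sup[OF joinands] R_def by simp
  ultimately have "joinand A ` S = canonical_joinands R"
    using canonical_joinands_irredundant[OF R] unfolding irredundant_join_representation_def by blast
  then show "\<exists>R\<in>AR. canonical_join_representation L R (joinand A ` S)"
    using canonical_joinands_canonical[OF R] R by auto
qed

end

section \<open>Order isomorphisms and simplicial complexes\<close>

lemma is_lub_carrier_iff:
  assumes "J \<subseteq> carrier L"
  shows "is_lub L x J \<longleftrightarrow> x \<in> carrier L \<and> (\<forall>y\<in>J. y \<sqsubseteq>\<^bsub>L\<^esub> x) \<and>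
    (\<forall>u\<in>carrier L. (\<forall>y\<in>J. y \<sqsubseteq>\<^bsub>L\<^esub> u) \<longrightarrow> x \<sqsubseteq>\<^bsub>L\<^esub> u)"
proof -
  have "J \<inter> carrier L = J" using assms by blast
  then show ?thesis unfolding least_def Upper_def by blast
qed

text \<open>Transports canonical join complexes along complementation into the opposite
  poset.\<close>

locale order_isomorphism =
  fixes L :: "('a, 'c) gorder_scheme" and M :: "('b, 'd) gorder_scheme" and f :: "'a \<Rightarrow> 'b"
  assumes bij: "bij_betw f (carrier L) (carrier M)"
    and le_iff: "\<And>x y. x \<in> carrier L \<Longrightarrow> y \<in> carrier L \<Longrightarrow> f x \<sqsubseteq>\<^bsub>M\<^esub> f y \<longleftrightarrow> x \<sqsubseteq>\<^bsub>L\<^esub> y"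
begin

lemma inj: "inj_on f (carrier L)" and carrier_image: "carrier M = f ` carrier L"
  using bij by (auto simp: bij_betw_def)

lemma is_lub_image:
  assumes "x \<in> carrier L" "J \<subseteq> carrier L"
  shows "is_lub M (f x) (f ` J) \<longleftrightarrow> is_lub L x J"
proof -
  have J: "f ` J \<subseteq> carrier M" using assms(2) carrier_image by blast
  have le: "f y \<sqsubseteq>\<^bsub>M\<^esub> f z \<longleftrightarrow> y \<sqsubseteq>\<^bsub>L\<^esub> z" if "y \<in> J \<union> {x}" "z \<in> carrier L" for y z
    using that assms le_iff by blast
  show ?thesis
    unfolding is_lub_carrier_iff[OF J] is_lub_carrier_iff[OF assms(2)]
    using assms(1) by (simp add: carrier_image le cong: ball_cong)
qed

lemma join_irreducible_image:
  assumes x: "x \<in> carrier L"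
  shows "join_irreducible M (f x) \<longleftrightarrow> join_irreducible L x"
proof -
  have "least M (f x) (carrier M) \<longleftrightarrow> least L x (carrier L)"
    using x le_iff by (simp add: least_def carrier_image)
  moreover have "is_lub M (f x) {f y, f z} \<longleftrightarrow> is_lub L x {y, z}"
    if "y \<in> carrier L" "z \<in> carrier L" for y z
    using is_lub_image[OF x, of "{y, z}"] that by simp
  moreover have "f x = f y \<longleftrightarrow> x = y" if "y \<in> carrier L" for y
    using inj_on_eq_iff[OF inj x that] .
  ultimately show ?thesis
    using x by (simp add: join_irreducible_def carrier_image cong: ball_cong)
qed

lemma irredundant_image:
  assumes x: "x \<in> carrier L" and J: "J \<subseteq> carrier L"
  shows "irredundant_join_representation M (f x) (f ` J) \<longleftrightarrow> irredundant_join_representation L x J"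
proof -
  have inj_J: "inj_on f J" using inj_on_subset[OF inj J] .
  have "(\<forall>J'. J' \<subset> f ` J \<longrightarrow> \<not> is_lub M (f x) J') \<longleftrightarrow> (\<forall>K. K \<subset> J \<longrightarrow> \<not> is_lub M (f x) (f ` K))"
  proof (intro iffI allI impI)
    fix K assume "\<forall>J'. J' \<subset> f ` J \<longrightarrow> \<not> is_lub M (f x) J'" "K \<subset> J"
    moreover from this(2) have "f ` K \<subset> f ` J" by (rule image_strict_mono[OF inj_J])
    ultimately show "\<not> is_lub M (f x) (f ` K)" by simp
  next
    fix J' assume all: "\<forall>K. K \<subset> J \<longrightarrow> \<not> is_lub M (f x) (f ` K)" and J': "J' \<subset> f ` J"
    then have "J' \<subseteq> f ` J" by simp
    then obtain K where "K \<subseteq> J" "J' = f ` K" by (rule subset_imageE)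
    moreover from this J' have "K \<noteq> J" by blast
    ultimately show "\<not> is_lub M (f x) J'" using all by blast
  qed
  also have "\<dots> \<longleftrightarrow> (\<forall>K. K \<subset> J \<longrightarrow> \<not> is_lub L x K)"
  proof -
    have "is_lub M (f x) (f ` K) \<longleftrightarrow> is_lub L x K" if "K \<subset> J" for K
      by (rule is_lub_image[OF x]) (use that J in blast)
    then show ?thesis by simp
  qed
  finally show ?thesis
    using is_lub_image[OF x J] J
    by (simp add: irredundant_join_representation_def join_representation_def carrier_image image_mono)
qed

lemma canonical_image:
  assumes x: "x \<in> carrier L" and J: "J \<subseteq> carrier L"
  shows "canonical_join_representation M (f x) (f ` J) \<longleftrightarrow> canonical_join_representation L x J"
proof -
  have irr_carrier: "K \<subseteq> carrier L" if "irredundant_join_representation L x K" for K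
    using that by (simp add: irredundant_join_representation_def join_representation_def)
  have ref: "join_refines M (f ` J) (f ` K) \<longleftrightarrow> join_refines L J K" if "K \<subseteq> carrier L" for K
  proof -
    have "f y \<sqsubseteq>\<^bsub>M\<^esub> f z \<longleftrightarrow> y \<sqsubseteq>\<^bsub>L\<^esub> z" if "y \<in> J" "z \<in> K" for y z
      using that \<open>K \<subseteq> carrier L\<close> J le_iff by blast
    then show ?thesis by (simp add: join_refines_def)
  qed
  have "(\<forall>J'. irredundant_join_representation M (f x) J' \<longrightarrow> join_refines M (f ` J) J') \<longleftrightarrow>
        (\<forall>K. irredundant_join_representation L x K \<longrightarrow> join_refines L J K)"
  proof (intro iffI allI impI)
    fix K assume "\<forall>J'. irredundant_join_representation M (f x) J' \<longrightarrow> join_refines M (f ` J) J'"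
      and K: "irredundant_join_representation L x K"
    then show "join_refines L J K"
      using ref[OF irr_carrier[OF K]] irredundant_image[OF x irr_carrier[OF K]] by blast
  next
    fix J' assume all: "\<forall>K. irredundant_join_representation L x K \<longrightarrow> join_refines L J K"
      and J': "irredundant_join_representation M (f x) J'"
    then have "J' \<subseteq> f ` carrier L"
      by (simp add: irredundant_join_representation_def join_representation_def carrier_image)
    then obtain K where K: "K \<subseteq> carrier L" "J' = f ` K" by (rule subset_imageE)
    then show "join_refines M (f ` J) J'"
      using all J' irredundant_image[OF x K(1)] ref[OF K(1)] by blast
  qed
  then show ?thesis
    using irredundant_image[OF x J] by (simp add: canonical_join_representation_def)
qed

lemma canonical_join_complex_image:
  "canonical_join_complex M =
    (f ` fst (canonical_join_complex L), (`) f ` snd (canonical_join_complex L))"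
proof -
  have "{x. join_irreducible M x} = f ` {x. join_irreducible L x}"
  proof (intro equalityI subsetI)
    fix y assume "y \<in> {x. join_irreducible M x}"
    then have y: "join_irreducible M y" by simp
    then obtain x where "x \<in> carrier L" "y = f x"
      by (auto simp: join_irreducible_def carrier_image)
    then show "y \<in> f ` {x. join_irreducible L x}" using y join_irreducible_image by blast
  next
    fix y assume "y \<in> f ` {x. join_irreducible L x}"
    then obtain x where x: "join_irreducible L x" "y = f x" by blast
    then have "x \<in> carrier L" by (simp add: join_irreducible_def)
    then show "y \<in> {x. join_irreducible M x}" using join_irreducible_image x by simp
  qed
  moreover have "{J. \<exists>x\<in>carrier M. canonical_join_representation M x J} =
    (`) f ` {J. \<exists>x\<in>carrier L. canonical_join_representation L x J}"
  proof (intro equalityI subsetI)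
    fix J' assume "J' \<in> {J. \<exists>x\<in>carrier M. canonical_join_representation M x J}"
    then obtain y where y: "y \<in> carrier M" and J': "canonical_join_representation M y J'" by blast
    then have "J' \<subseteq> f ` carrier L"
      by (simp add: canonical_join_representation_def irredundant_join_representation_def
          join_representation_def carrier_image)
    then obtain K where K: "K \<subseteq> carrier L" "J' = f ` K" by (rule subset_imageE)
    obtain x where x: "x \<in> carrier L" "y = f x" using y carrier_image by blast
    have "canonical_join_representation L x K" using canonical_image[OF x(1) K(1)] J' x K by simp
    then show "J' \<in> (`) f ` {J. \<exists>x\<in>carrier L. canonical_join_representation L x J}"
      using K(2) x(1) by blast
  next
    fix J' assume "J' \<in> (`) f ` {J. \<exists>x\<in>carrier L. canonical_join_representation L x J}"
    then obtain J x where x: "x \<in> carrier L" and J: "canonical_join_representation L x J"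
      and J': "J' = f ` J" by blast
    then have "J \<subseteq> carrier L"
      by (simp add: canonical_join_representation_def irredundant_join_representation_def
          join_representation_def)
    then have "canonical_join_representation M (f x) (f ` J)" using canonical_image[OF x] J by simp
    then show "J' \<in> {J. \<exists>x\<in>carrier M. canonical_join_representation M x J}"
      using x J' carrier_image by blast
  qed
  ultimately show ?thesis unfolding canonical_join_complex_def by simp
qed

end

text \<open>The given bijection runs from \<open>K'\<close> to \<open>K\<close>, as
  \<open>joinand\<close> does; its inverse is the isomorphism. Finiteness and downward closure of
  \<open>K\<close> are inherited from \<open>K'\<close> through the face correspondence.\<close>

lemma complex_isomorphicI:
  assumes g: "bij_betw g (fst K') (fst K)" and K': "abstract_complex K'"
    and faces: "\<And>S. S \<subseteq> fst K' \<Longrightarrow> g ` S \<in> snd K \<longleftrightarrow> S \<in> snd K'"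
    and sub: "\<And>S. S \<in> snd K \<Longrightarrow> S \<subseteq> fst K"
  shows "complex_isomorphic K K'"
proof -
  let ?f = "inv_into (fst K') g"
  have img: "fst K = g ` fst K'" and inj: "inj_on g (fst K')"
    using g by (auto simp: bij_betw_def)
  have inv_img: "?f ` g ` S = S" if "S \<subseteq> fst K'" for S
    using inv_into_image_cancel[OF inj that] .
  have "abstract_complex K"
    unfolding abstract_complex_def
  proof (intro ballI conjI allI impI)
    fix S assume S: "S \<in> snd K"
    then show "S \<subseteq> fst K" by (rule sub)
    then obtain S' where S': "S' \<subseteq> fst K'" "S = g ` S'" unfolding img by (rule subset_imageE)
    then have face: "S' \<in> snd K'" using faces S by simp
    then show "finite S" using K' S'(2) by (simp add: abstract_complex_def)
    fix T assume "T \<subseteq> S"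
    then obtain T' where T': "T' \<subseteq> S'" "T = g ` T'" unfolding S'(2) by (rule subset_imageE)
    then have "T' \<in> snd K'" using K' face by (auto simp: abstract_complex_def)
    then show "T \<in> snd K" using faces[of T'] T' S'(1) by simp
  qed
  moreover have "bij_betw ?f (fst K) (fst K')" using bij_betw_inv_into[OF g] .
  moreover have "S \<in> snd K \<longleftrightarrow> ?f ` S \<in> snd K'" if "S \<subseteq> fst K" for S
  proof -
    obtain S' where S': "S' \<subseteq> fst K'" "S = g ` S'" using \<open>S \<subseteq> fst K\<close> unfolding img by (rule subset_imageE)
    then show ?thesis using faces inv_img by simp
  qed
  ultimately show ?thesis unfolding complex_isomorphic_def using K' by blast
qed

section \<open>The two isomorphisms with the non-crossing rope complex\<close>

context skeletal_dag
begin

lemma abstract_non_crossing_rope_complex: "abstract_complex (non_crossing_rope_complex A)"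
proof -
  have "ropes A \<subseteq> V \<times> V \<times> Pow V \<times> Pow V"
  proof
    fix r assume "r \<in> ropes A"
    moreover obtain u v N D where r: "r = (u, v, N, D)" by (cases r)
    ultimately have "(u, v) \<in> A" "N \<union> D \<subseteq> {w. (u, w) \<in> A \<and> (w, v) \<in> A}"
      unfolding r ropes_iff by blast+
    then show "r \<in> V \<times> V \<times> Pow V \<times> Pow V" using arcs_subset unfolding r by blast
  qed
  then have "finite (ropes A)" using finite_vertices by (simp add: finite_subset)
  then have "finite S \<and> S \<subseteq> ropes A \<and> (\<forall>T\<subseteq>S. non_crossing_rope_diagram A T)"
    if "non_crossing_rope_diagram A S" for S
    using that finite_subset pairwise_subset unfolding non_crossing_rope_diagram_def
    by (metis subset_trans)
  then show ?thesis by (simp add: abstract_complex_def non_crossing_rope_complex_def)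
qed

lemma joinand_vertices: "fst (canonical_join_complex L) = joinand A ` ropes A"
  using join_irreducible_iff by (auto simp: canonical_join_complex_def simp del: joinand.simps)

lemma joinand_face_iff:
  "S \<subseteq> ropes A \<Longrightarrow> joinand A ` S \<in> snd (canonical_join_complex L) \<longleftrightarrow> non_crossing_rope_diagram A S"
  unfolding canonical_join_complex_def carrier_L snd_conv mem_Collect_eq
  by (rule joinand_image_face_iff)

lemma canonical_faces_subset:
  assumes "J \<in> snd (canonical_join_complex L)"
  shows "J \<subseteq> fst (canonical_join_complex L)"
proof -
  obtain R where R: "R \<in> AR" "J = canonical_joinands R"
    using assms canonical_join_representation_iff by (auto simp: canonical_join_complex_def carrier_L)
  show ?thesis
    unfolding joinand_vertices R(2) canonical_joinands_def
    using rope_at_ropes[OF R(1)] descentsD(1) by blast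
qed

lemma canonical_join_complex_isomorphic:
  "complex_isomorphic (canonical_join_complex L) (non_crossing_rope_complex A)"
proof (rule complex_isomorphicI[where g = "joinand A"])
  show "bij_betw (joinand A) (fst (non_crossing_rope_complex A)) (fst (canonical_join_complex L))"
    using joinand_inj joinand_vertices by (simp add: bij_betw_def non_crossing_rope_complex_def)
qed (use abstract_non_crossing_rope_complex joinand_face_iff canonical_faces_subset in
    \<open>simp_all add: non_crossing_rope_complex_def\<close>)

lemma order_isomorphism_complement: "order_isomorphism L (inv_gorder L) (\<lambda>R. A - R)"
proof
  show "bij_betw (\<lambda>R. A - R) (carrier L) (carrier (inv_gorder L))"
    by (rule bij_betw_byWitness[where f' = "\<lambda>R. A - R"])
      (use AR_D(1) AR_complement in \<open>auto simp: carrier_L\<close>)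
  show "A - R \<sqsubseteq>\<^bsub>inv_gorder L\<^esub> A - S \<longleftrightarrow> R \<sqsubseteq>\<^bsub>L\<^esub> S" if "R \<in> carrier L" "S \<in> carrier L" for R S
    using that AR_D(1)[of R] AR_D(1)[of S] by (auto simp: carrier_L le_L)
qed

lemma canonical_meet_complex_isomorphic:
  "complex_isomorphic (canonical_meet_complex L) (non_crossing_rope_complex A)"
proof (rule complex_isomorphicI[where g = "(\<lambda>R. A - R) \<circ> joinand A"])
  note iso = order_isomorphism_complement
  let ?K = "canonical_join_complex L"
  have meet: "fst (canonical_meet_complex L) = (\<lambda>R. A - R) ` fst ?K"
    "snd (canonical_meet_complex L) = (`) (\<lambda>R. A - R) ` snd ?K"
    unfolding canonical_meet_complex_def order_isomorphism.canonical_join_complex_image[OF iso]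
    by (simp_all only: fst_conv snd_conv)
  have "fst ?K \<subseteq> carrier L" by (auto simp: canonical_join_complex_def join_irreducible_def)
  then have inj: "inj_on (\<lambda>R. A - R) (fst ?K)" using order_isomorphism.inj[OF iso] by (rule inj_on_subset[rotated])
  show "bij_betw ((\<lambda>R. A - R) \<circ> joinand A) (fst (non_crossing_rope_complex A))
      (fst (canonical_meet_complex L))"
    using joinand_inj inj unfolding meet joinand_vertices
    by (simp add: bij_betw_def non_crossing_rope_complex_def comp_inj_on image_comp)
  show "((\<lambda>R. A - R) \<circ> joinand A) ` S \<in> snd (canonical_meet_complex L) \<longleftrightarrow>
      S \<in> snd (non_crossing_rope_complex A)"
    if "S \<subseteq> fst (non_crossing_rope_complex A)" for S
  proof -
    have S: "S \<subseteq> ropes A" using that by (simp add: non_crossing_rope_complex_def)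
    \<comment> \<open>Faces are subsets of the vertex set, so injectivity of complementation on
      vertices lifts to injectivity on faces.\<close>
    have "snd ?K \<subseteq> Pow (fst ?K)" "joinand A ` S \<in> Pow (fst ?K)"
      using canonical_faces_subset S joinand_vertices by blast+
    then have "(\<lambda>R. A - R) ` joinand A ` S \<in> (`) (\<lambda>R. A - R) ` snd ?K \<longleftrightarrow> joinand A ` S \<in> snd ?K"
      using inj_on_image_mem_iff[OF inj_on_image_Pow[OF inj], of "joinand A ` S" "snd ?K"] by simp
    then show ?thesis
      using joinand_face_iff[OF S]
      by (simp only: meet image_comp[symmetric] non_crossing_rope_complex_def snd_conv mem_Collect_eq)
  qed
  show "S \<subseteq> fst (canonical_meet_complex L)" if "S \<in> snd (canonical_meet_complex L)" for S
  proof -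
    obtain J where J: "J \<in> snd ?K" "S = (\<lambda>R. A - R) ` J"
      using \<open>S \<in> snd (canonical_meet_complex L)\<close> unfolding meet by (rule imageE)
    show ?thesis unfolding meet J(2) by (intro image_mono canonical_faces_subset J(1))
  qed
qed (rule abstract_non_crossing_rope_complex)

end

theorem corollary31:
  fixes V :: "'a set" and A :: "('a \<times> 'a) set"
  assumes "dag V A" and "skeletal V A"
  shows "complex_isomorphic (canonical_join_complex (acyclic_reorientation_poset A))
           (non_crossing_rope_complex A) \<and>
         complex_isomorphic (canonical_meet_complex (acyclic_reorientation_poset A))
           (non_crossing_rope_complex A)"
proof -
  interpret skeletal_dag V A using assms by unfold_locales
  show ?thesis using canonical_join_complex_isomorphic canonical_meet_complex_isomorphic ..
qed

end
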